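(* Let $\mathbb{F}=\mathbb{C}$ or $\mathbb{F}=\mathbb{R}$, and let $A,B\in\mathbb{F}^{n\times n}$ with $A$ Lyapunov regular and $B\in\{A\}_{\mathbb{F}}''$. Let $\mathcal{L}_{A,B}=\mathcal{L}_B\circ\mathcal{L}_A^{-1}:\mathbb{F}^{n\times n}\to\mathbb{F}^{n\times n}$, where $\mathcal{L}_Y(X)=XY+Y^*X$. Then $\mathcal{L}_{A,B}$ is positive if and only if $\mathcal{L}_{A,B}$ is completely positive. Hence $\mathcal{L}_{A,B}$ is positive if and only if the Choi matrix $\mathbb{L}_{A,B}\in\mathbb{F}^{n^2\times n^2}$ of $\mathcal{L}_{A,B}$ is positive semidefinite.
   Context: For $\mathbb{F}=\mathbb{R}$, read $X^*$ as the transpose and "Hermitian" as "symmetric"; positive semidefinite matrices are Hermitian matrices with entries in $\mathbb{F}$ with nonnegative quadratic form on $\mathbb{F}^n$. A matrix $A\in\mathbb{F}^{n\times n}$ with (complex) eigenvalues $\lambda_1,\dots,\lambda_n$ is Lyapunov regular if $\lambda_i+\overline{\lambda}_j\neq 0$ for all $i,j=1,\dots,n$. In that case the linear map $\mathcal{L}_A:\mathbb{F}^{n\times n}\to\mathbb{F}^{n\times n}$, $\mathcal{L}_A(X)=XA+A^*X$, is bijective, so $\mathcal{L}_A^{-1}$ exists. The bicommutant $\{A\}_{\mathbb{F}}''$ is the set of matrices in $\mathbb{F}^{n\times n}$ commuting with every matrix in $\mathbb{F}^{n\times n}$ that commutes with $A$; equivalently $\{A\}_{\mathbb{F}}''=\{p(A):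 p\in\mathbb{F}[x]\}$. A linear map $\mathcal{L}:\mathbb{F}^{q\times q}\to\mathbb{F}^{n\times n}$ is positive if it maps positive semidefinite matrices to positive semidefinite matrices, and completely positive if for every $k\ge 1$ the map $[V_{ij}]_{i,j=1}^k\mapsto[\mathcal{L}(V_{ij})]_{i,j=1}^k$ from $\mathbb{F}^{kq\times kq}$ to $\mathbb{F}^{kn\times kn}$ is positive. The Choi matrix of $\mathcal{L}$ is the block matrix $\mathbb{L}=[\mathcal{L}(\mathcal{E}_{ij})]_{i,j=1}^q\in\mathbb{F}^{nq\times nq}$, where $\mathcal{E}_{ij}\in\mathbb{F}^{q\times q}$ is the matrix unit with $1$ in position $(i,j)$ and zeros elsewhere. *)

theory Defs
  imports "Jordan_Normal_Form.Char_Poly" "Jordan_Normal_Form.Schur_Decomposition"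
begin

text \<open>
  The matrix notions below are generic in the scalar type and are meant for the two instances
  \<^typ>\<open>complex\<close> and \<^typ>\<open>real\<close>: there \<^const>\<open>conjugate\<close> is complex conjugation and the
  identity, respectively, so that \<^const>\<open>mat_adjoint\<close> is the conjugate transpose and the
  transpose. The order on \<^typ>\<open>complex\<close> is the one of HOL-Library.Complex_Order, in which
  \<open>0 \<le> z\<close> says that \<open>z\<close> is real and nonnegative.
\<close>

definition hermitian_mat :: "'a :: conjugatable_ordered_field mat \<Rightarrow> bool" where
  "hermitian_mat X \<longleftrightarrow> mat_adjoint X = X"

text \<open>\<open>(X *\<^sub>v v) \<bullet>c v\<close> is the quadratic form \<open>v\<^sup>* X v\<close>.\<close>

definition psd_mat :: "nat \<Rightarrow> 'a :: conjugatable_ordered_field mat \<Rightarrow> bool" where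
  "psd_mat n X \<longleftrightarrow> X \<in> carrier_mat n n \<and> hermitian_mat X \<and>
     (\<forall>v \<in> carrier_vec n. 0 \<le> (X *\<^sub>v v) \<bullet>c v)"

text \<open>The eigenvalues are the complex ones; a real matrix has to be embedded first.\<close>

definition lyapunov_regular :: "complex mat \<Rightarrow> bool" where
  "lyapunov_regular A \<longleftrightarrow>
     (\<forall>l m. eigenvalue A l \<longrightarrow> eigenvalue A m \<longrightarrow> l + cnj m \<noteq> 0)"

definition lyapunov_op :: "'a :: conjugatable_ordered_field mat \<Rightarrow> 'a mat \<Rightarrow> 'a mat" where
  "lyapunov_op Y X = X * Y + mat_adjoint Y * X"

text \<open>
  \<open>\<L>\<^sub>B \<circ> \<L>\<^sub>A\<^sup>-\<^sup>1\<close> on \<open>n \<times> n\<close> matrices. The inverse is the genuine two-sided one whenever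
  \<open>\<L>\<^sub>A\<close> is a bijection of \<^term>\<open>carrier_mat n n\<close>, in particular for Lyapunov regular \<open>A\<close>.
\<close>

definition lyapunov_quot ::
    "nat \<Rightarrow> 'a :: conjugatable_ordered_field mat \<Rightarrow> 'a mat \<Rightarrow> 'a mat \<Rightarrow> 'a mat" where
  "lyapunov_quot n A B = lyapunov_op B \<circ> inv_into (carrier_mat n n) (lyapunov_op A)"

definition bicommutant :: "nat \<Rightarrow> 'a :: conjugatable_ordered_field mat \<Rightarrow> 'a mat set" where
  "bicommutant n A = {B \<in> carrier_mat n n.
     \<forall>C \<in> carrier_mat n n. C * A = A * C \<longrightarrow> B * C = C * B}"

text \<open>
  \<open>L\<close> is thought of as a linear map from \<open>q \<times> q\<close> to \<open>n \<times> n\<close> matrices; its values outside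
  \<^term>\<open>carrier_mat q q\<close> are irrelevant in the following definitions.
\<close>

definition positive_map ::
    "nat \<Rightarrow> nat \<Rightarrow> ('a :: conjugatable_ordered_field mat \<Rightarrow> 'a mat) \<Rightarrow> bool" where
  "positive_map q n L \<longleftrightarrow> (\<forall>X. psd_mat q X \<longrightarrow> psd_mat n (L X))"

text \<open>The \<open>kn \<times> kn\<close> matrix whose block in position \<open>(i, j)\<close> is the \<open>n \<times> n\<close> matrix \<open>W i j\<close>.\<close>

definition block_mat :: "nat \<Rightarrow> nat \<Rightarrow> (nat \<Rightarrow> nat \<Rightarrow> 'a mat) \<Rightarrow> 'a mat" where
  "block_mat k n W =
     mat (k * n) (k * n) (\<lambda>(r, s). W (r div n) (s div n) $$ (r mod n, s mod n))"

text \<open>The \<open>q \<times> q\<close> block of \<open>V\<close> in position \<open>(i, j)\<close>.\<close>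

definition mat_block :: "nat \<Rightarrow> 'a mat \<Rightarrow> nat \<Rightarrow> nat \<Rightarrow> 'a mat" where
  "mat_block q V i j = mat q q (\<lambda>(r, s). V $$ (i * q + r, j * q + s))"

definition completely_positive_map ::
    "nat \<Rightarrow> nat \<Rightarrow> ('a :: conjugatable_ordered_field mat \<Rightarrow> 'a mat) \<Rightarrow> bool" where
  "completely_positive_map q n L \<longleftrightarrow>
     (\<forall>k \<ge> 1. positive_map (k * q) (k * n) (\<lambda>V. block_mat k n (\<lambda>i j. L (mat_block q V i j))))"

definition matrix_unit :: "nat \<Rightarrow> nat \<Rightarrow> nat \<Rightarrow> 'a :: conjugatable_ordered_field mat" where
  "matrix_unit q i j = mat q q (\<lambda>(r, s). if r = i \<and> s = j then 1 else 0)"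

definition choi_mat ::
    "nat \<Rightarrow> nat \<Rightarrow> ('a :: conjugatable_ordered_field mat \<Rightarrow> 'a mat) \<Rightarrow> 'a mat" where
  "choi_mat q n L = block_mat q n (\<lambda>i j. L (matrix_unit q i j))"

end

theory Submission
  imports Defs "HOL-Computational_Algebra.Field_as_Ring"
begin

text \<open>
  The map \<open>L = \<L>\<^sub>B \<circ> \<L>\<^sub>A\<^sup>-\<^sup>1\<close> satisfies \<open>L(C\<^sup>* X D) = C\<^sup>* L(X) D\<close> for all \<open>C\<close>, \<open>D\<close> in the commutant of \<open>A\<close>,
  because both Lyapunov operators do. The commutant has a cyclic vector \<open>w\<close>: any vector whose local
  minimal polynomial is the minimal polynomial of \<open>A\<close>. Writing vectors as \<open>x\<^sub>i = C\<^sub>i w\<close> reduces the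
  quadratic form of a block matrix \<open>[L(V\<^sub>i\<^sub>j)]\<close> to that of \<open>L\<close> at a single positive semidefinite matrix,
  so positivity implies complete positivity. Conversely, a positive semidefinite Choi matrix
  gives positivity, since \<open>\<Sum> X\<^sub>i\<^sub>j M\<^sub>i\<^sub>j \<ge> 0\<close> for positive semidefinite \<open>X\<close> and \<open>M\<close>. The two
  scalar fields only differ in the argument for the injectivity of \<open>\<L>\<^sub>A\<close>.
\<close>

subsection \<open>Adjoints and linear systems\<close>

text \<open>The obstacle is that \<open>A\<close> may be derogatory: then the polynomials in
  \<open>A\<close> have no cyclic vector, although the whole commutant still has one. Hence the
  bimodule identity is required over everything that commutes with \<open>A\<close>, and the
  bicommutant hypothesis on \<open>B\<close> is what makes \<open>\<L>\<^sub>B\<close> satisfy it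
  over the same algebra. Eigenvectors may be missing over the reals, so the cyclic vector is found
  by divisibility of polynomials alone. Sending \<open>w\<close> to \<open>x\<close> is well defined
  on the span of the vectors \<open>A\<^sup>j w\<close>, because the minimal polynomial of
  \<open>A\<close>, which is also the local one of \<open>w\<close>, annihilates \<open>x\<close>.
  The difficulty is to extend this map to the whole space so that it commutes with \<open>A\<close>.
  A single functional \<open>f\<close> solves it: the common kernel of the functionals
  \<open>f A\<^sup>i\<close> is an \<open>A\<close>-invariant complement of that span, and inverting
  a Hankel matrix makes the projection along it explicit.\<close>

lemma mat_adjoint_carrier [simp]:
  "A \<in> carrier_mat n m \<Longrightarrow> mat_adjoint A \<in> carrier_mat m n"
  "dim_row (mat_adjoint A) = dim_col A" "dim_col (mat_adjoint A) = dim_row A"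
  by (auto simp: mat_adjoint_def mat_of_rows_def)

lemma mat_adjoint_index [simp]:
  "i < dim_col A \<Longrightarrow> j < dim_row A \<Longrightarrow> mat_adjoint A $$ (i, j) = conjugate (A $$ (j, i))"
  by (simp add: mat_adjoint_def mat_of_rows_def conjugate_vec_def)

lemma mat_adjoint_add:
  "A \<in> carrier_mat n m \<Longrightarrow> B \<in> carrier_mat n m \<Longrightarrow>
    mat_adjoint (A + B) = mat_adjoint A + mat_adjoint B"
  by (intro eq_matI) (auto simp: conjugate_dist_add)

lemma mat_adjoint_mult:
  "A \<in> carrier_mat n m \<Longrightarrow> B \<in> carrier_mat m k \<Longrightarrow>
    mat_adjoint (A * B) = mat_adjoint B * mat_adjoint A"
  by (intro eq_matI)
    (auto simp: scalar_prod_def sum_conjugate conjugate_dist_mul mult.commute intro!: sum.cong)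

lemma mat_adjoint_adjoint [simp]: "mat_adjoint (mat_adjoint A) = A"
  by (intro eq_matI) auto

lemma mat_adjoint_cscalar_prod:
  fixes A :: "'a :: conjugatable_field mat"
  assumes "A \<in> carrier_mat n m" "v \<in> carrier_vec m" "w \<in> carrier_vec n"
  shows "(A *\<^sub>v v) \<bullet>c w = v \<bullet>c (mat_adjoint A *\<^sub>v w)"
proof -
  have "(A *\<^sub>v v) \<bullet>c w = (\<Sum>i<n. \<Sum>j<m. A $$ (i, j) * v $ j * conjugate (w $ i))"
    using assms by (auto simp: scalar_prod_def sum_distrib_right lessThan_atLeast0 intro!: sum.cong)
  also have "\<dots> = (\<Sum>j<m. \<Sum>i<n. A $$ (i, j) * v $ j * conjugate (w $ i))"
    by (rule sum.swap)
  also have "\<dots> = v \<bullet>c (mat_adjoint A *\<^sub>v w)"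
    using assms
    by (auto simp: scalar_prod_def sum_distrib_left lessThan_atLeast0 sum_conjugate conjugate_dist_mul
        ac_simps intro!: sum.cong)
  finally show ?thesis .
qed

lemma trivial_kernel_imp_invertible:
  fixes M :: "'a :: field mat"
  assumes M: "M \<in> carrier_mat n n"
    and ker: "\<And>v. v \<in> carrier_vec n \<Longrightarrow> M *\<^sub>v v = 0\<^sub>v n \<Longrightarrow> v = 0\<^sub>v n"
  obtains N where "N \<in> carrier_mat n n" "N * M = 1\<^sub>m n" "M * N = 1\<^sub>m n"
proof -
  have "det M \<noteq> 0"
    using ker det_0_iff_vec_prod_zero_field[OF M] by blast
  from det_non_zero_imp_unit[OF M this, of "()"] show ?thesis
    using that by (auto simp: Units_def ring_mat_def)
qed

text \<open>Zero rows pad \<open>U\<close> to a square matrix. Its transpose annihilates the last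
  unit vector, so the determinant vanishes.\<close>

lemma wide_matrix_kernel:
  fixes U :: "'a :: field mat"
  assumes U: "U \<in> carrier_mat n m" and "n < m"
  obtains c where "c \<in> carrier_vec m" "c \<noteq> 0\<^sub>v m" "U *\<^sub>v c = 0\<^sub>v n"
proof -
  define M where "M = mat m m (\<lambda>(i, j). if i < n then U $$ (i, j) else 0)"
  have M: "M \<in> carrier_mat m m" by (simp add: M_def)
  have "M\<^sup>T *\<^sub>v unit_vec m (m - 1) = 0\<^sub>v m"
    using \<open>n < m\<close> by (intro eq_vecI) (auto simp: M_def)
  moreover have "unit_vec m (m - 1) \<noteq> (0\<^sub>v m :: 'a vec)"
    using \<open>n < m\<close> by (auto simp: vec_eq_iff intro!: exI[of _ "m - 1"])
  ultimately have "det (M\<^sup>T) = 0"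
    using det_0_iff_vec_prod_zero_field[of "M\<^sup>T" m] M by (auto intro: unit_vec_carrier)
  hence "det M = 0" using det_transpose[OF M] by simp
  then obtain c where c: "c \<in> carrier_vec m" "c \<noteq> 0\<^sub>v m" "M *\<^sub>v c = 0\<^sub>v m"
    using det_0_iff_vec_prod_zero_field[OF M] by blast
  have "U *\<^sub>v c = 0\<^sub>v n"
  proof (rule eq_vecI)
    fix i assume i: "i < dim_vec (0\<^sub>v n :: 'a vec)"
    have "row M i = row U i"
      using i \<open>n < m\<close> U by (intro eq_vecI) (auto simp: M_def)
    thus "(U *\<^sub>v c) $ i = 0\<^sub>v n $ i"
      using arg_cong[OF c(3), of "\<lambda>v. v $ i"] i \<open>n < m\<close> U M by simp
  qed (use U in auto)
  with c that show ?thesis by blast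
qed

text \<open>The Gram matrix \<open>U\<^sup>* U\<close> is invertible because \<open>\<parallel>U c\<parallel>\<^sup>2 = c\<^sup>* U\<^sup>* U c\<close>.\<close>
lemma trivial_kernel_imp_left_inverse:
  fixes U :: "'a :: conjugatable_ordered_field mat"
  assumes U: "U \<in> carrier_mat n d"
    and ker: "\<And>c. c \<in> carrier_vec d \<Longrightarrow> U *\<^sub>v c = 0\<^sub>v n \<Longrightarrow> c = 0\<^sub>v d"
  obtains V where "V \<in> carrier_mat d n" "V * U = 1\<^sub>m d"
proof -
  let ?G = "mat_adjoint U * U"
  have adj: "mat_adjoint U \<in> carrier_mat d n" using U by simp
  have G: "?G \<in> carrier_mat d d" using mult_carrier_mat[OF adj U] .
  have "c = 0\<^sub>v d" if c: "c \<in> carrier_vec d" "?G *\<^sub>v c = 0\<^sub>v d" for c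
  proof -
    have Uc: "U *\<^sub>v c \<in> carrier_vec n" using U c by simp
    have "(U *\<^sub>v c) \<bullet>c (U *\<^sub>v c) = c \<bullet>c (mat_adjoint U *\<^sub>v (U *\<^sub>v c))"
      using mat_adjoint_cscalar_prod[OF U c(1) Uc] .
    also have "mat_adjoint U *\<^sub>v (U *\<^sub>v c) = 0\<^sub>v d"
      using assoc_mult_mat_vec[OF adj U c(1)] c(2) by simp
    also have "c \<bullet>c 0\<^sub>v d = 0" using c by simp
    finally have "U *\<^sub>v c = 0\<^sub>v n" using conjugate_square_eq_0_vec[OF Uc] by simp
    with ker c show ?thesis by blast
  qed
  then obtain N where N: "N \<in> carrier_mat d d" "N * ?G = 1\<^sub>m d"
    using trivial_kernel_imp_invertible[OF G] by blast
  with adj U have "(N * mat_adjoint U) * U = 1\<^sub>m d"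
    by (simp add: assoc_mult_mat[of _ d d _ n _ d])
  with N adj that[of "N * mat_adjoint U"] show ?thesis by simp
qed

section \<open>Sums over block indices and quadratic forms in coordinates\<close>

lemma sum_lessThan_mult:
  fixes f :: "nat \<Rightarrow> 'a :: comm_monoid_add"
  shows "(\<Sum>r<k * n. f r) = (\<Sum>i<k. \<Sum>a<n. f (i * n + a))"
proof -
  have "(\<Sum>r<k * n. f r) = (\<Sum>i<k. sum f {i * n..<i * n + n})"
    by (rule sum.nat_group[symmetric])
  also have "\<dots> = (\<Sum>i<k. \<Sum>a<n. f (i * n + a))"
  proof (rule sum.cong[OF refl])
    fix i
    show "sum f {i * n..<i * n + n} = (\<Sum>a<n. f (i * n + a))"
      using sum.shift_bounds_nat_ivl[of f 0 "i * n" n]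
      by (simp add: lessThan_atLeast0 add.commute)
  qed
  finally show ?thesis .
qed

lemma mult_add_less_mult:
  fixes i k a n :: nat
  assumes "i < k" "a < n"
  shows "i * n + a < k * n"
proof -
  have "i * n + a < Suc i * n" using assms by simp
  also have "\<dots> \<le> k * n" using assms by (intro mult_le_mono1) simp
  finally show ?thesis .
qed

lemma quadratic_form_sum:
  fixes W :: "'a :: conjugatable_field mat"
  assumes "W \<in> carrier_mat n m" "x \<in> carrier_vec m" "y \<in> carrier_vec n"
  shows "(W *\<^sub>v x) \<bullet>c y = (\<Sum>i<n. \<Sum>j<m. W $$ (i, j) * x $ j * conjugate (y $ i))"
  using assms by (auto simp: scalar_prod_def sum_distrib_right lessThan_atLeast0 intro!: sum.cong)

subsection \<open>Krylov matrices and the action of polynomials\<close>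

definition krylov :: "nat \<Rightarrow> 'a :: comm_ring_1 mat \<Rightarrow> 'a vec \<Rightarrow> 'a mat" where
  "krylov d A v = mat (dim_row A) d (\<lambda>(i, j). ((A ^\<^sub>m j) *\<^sub>v v) $ i)"

text \<open>The vector \<open>p(A) v\<close>. As a Krylov matrix times a coefficient vector, it
  identifies polynomials annihilating \<open>v\<close> with kernel vectors of a matrix.\<close>

definition poly_act :: "'a :: comm_ring_1 mat \<Rightarrow> 'a poly \<Rightarrow> 'a vec \<Rightarrow> 'a vec" where
  "poly_act A p v = krylov (Suc (degree p)) A v *\<^sub>v vec (Suc (degree p)) (coeff p)"

lemma krylov_carrier [simp]:
  "A \<in> carrier_mat n n \<Longrightarrow> krylov d A v \<in> carrier_mat n d"
  "dim_row (krylov d A v) = dim_row A" "dim_col (krylov d A v) = d"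
  by (auto simp: krylov_def)

lemma krylov_mult_vec_index:
  assumes "A \<in> carrier_mat n n" "i < n"
  shows "(krylov N A v *\<^sub>v vec N c) $ i = (\<Sum>j<N. c j * ((A ^\<^sub>m j) *\<^sub>v v) $ i)"
  using assms by (auto simp: krylov_def scalar_prod_def lessThan_atLeast0 ac_simps intro!: sum.cong)

text \<open>The free bound \<open>N\<close> lets polynomials of different degrees share one index
  range.\<close>

lemma poly_act_index:
  assumes A: "A \<in> carrier_mat n n" and i: "i < n" and N: "\<And>j. j \<ge> N \<Longrightarrow> coeff p j = 0"
  shows "poly_act A p v $ i = (\<Sum>j<N. coeff p j * ((A ^\<^sub>m j) *\<^sub>v v) $ i)"
proof -
  let ?f = "\<lambda>j. coeff p j * ((A ^\<^sub>m j) *\<^sub>v v) $ i"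
  have "poly_act A p v $ i = sum ?f {..<Suc (degree p)}"
    unfolding poly_act_def by (rule krylov_mult_vec_index[OF A i])
  also have "\<dots> = sum ?f {..<max N (Suc (degree p))}"
    by (rule sum.mono_neutral_left) (simp_all add: coeff_eq_0)
  also have "\<dots> = sum ?f {..<N}"
    by (rule sum.mono_neutral_right) (simp_all add: N)
  finally show ?thesis .
qed

lemma poly_act_dim [simp]: "dim_vec (poly_act A p v) = dim_row A"
  by (simp only: poly_act_def dim_mult_mat_vec krylov_carrier(2))

lemma poly_act_carrier [simp]:
  "A \<in> carrier_mat n n \<Longrightarrow> poly_act A p v \<in> carrier_vec n"
  by (intro carrier_vecI) simp

lemma poly_act_eq_krylov:
  assumes A: "A \<in> carrier_mat n n" and N: "\<And>j. j \<ge> N \<Longrightarrow> coeff p j = 0"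
  shows "poly_act A p v = krylov N A v *\<^sub>v vec N (coeff p)"
proof (rule eq_vecI)
  fix i assume "i < dim_vec (krylov N A v *\<^sub>v vec N (coeff p))"
  thus "poly_act A p v $ i = (krylov N A v *\<^sub>v vec N (coeff p)) $ i"
    using A poly_act_index[OF A _ N] krylov_mult_vec_index[OF A] by simp
qed (use A poly_act_carrier[OF A] in auto)

lemma poly_act_add_poly:
  assumes A: "A \<in> carrier_mat n n"
  shows "poly_act A (p + q) v = poly_act A p v + poly_act A q v"
proof (rule eq_vecI)
  fix i assume "i < dim_vec (poly_act A p v + poly_act A q v)"
  hence i: "i < n" using A by auto
  let ?N = "Suc (max (degree p) (degree q))"
  have N: "coeff p j = 0" "coeff q j = 0" if "j \<ge> ?N" for j
    using that by (auto intro: coeff_eq_0)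
  show "poly_act A (p + q) v $ i = (poly_act A p v + poly_act A q v) $ i"
    using poly_act_index[OF A i, of ?N "p + q"] poly_act_index[OF A i, of ?N p]
      poly_act_index[OF A i, of ?N q] N i A
    by (simp add: sum.distrib distrib_right del: sum.lessThan_Suc)
qed (use poly_act_carrier[OF A] in auto)

lemma poly_act_smult:
  fixes A :: "'a :: idom mat"
  assumes A: "A \<in> carrier_mat n n"
  shows "poly_act A (smult a p) v = a \<cdot>\<^sub>v poly_act A p v"
proof (rule eq_vecI)
  fix i assume "i < dim_vec (a \<cdot>\<^sub>v poly_act A p v)"
  hence i: "i < n" using A by auto
  let ?N = "Suc (degree p)"
  have "coeff p j = 0" if "j \<ge> ?N" for j
    using that by (auto intro: coeff_eq_0)
  thus "poly_act A (smult a p) v $ i = (a \<cdot>\<^sub>v poly_act A p v) $ i"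
    using poly_act_index[OF A i, of ?N "smult a p"] poly_act_index[OF A i, of ?N p]
      i A
    by (simp add: sum_distrib_left mult.assoc del: sum.lessThan_Suc)
qed (use poly_act_carrier[OF A, of p v] poly_act_carrier[OF A, of "smult a p" v] in auto)

lemma poly_act_0 [simp]: "A \<in> carrier_mat n n \<Longrightarrow> poly_act A 0 v = 0\<^sub>v n"
  using poly_act_eq_krylov[of A n 0 0 v]
  by (auto intro!: eq_vecI simp: scalar_prod_def)

lemma zero_smult_vec [simp]:
  "v \<in> carrier_vec n \<Longrightarrow> 0 \<cdot>\<^sub>v v = (0\<^sub>v n :: 'a :: semiring_0 vec)"
  by (intro eq_vecI) auto

lemma pow_mat_Suc_left:
  assumes A: "A \<in> carrier_mat n n"
  shows "A ^\<^sub>m Suc j = A * A ^\<^sub>m j"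
proof (induction j)
  case (Suc j)
  have "A ^\<^sub>m Suc (Suc j) = (A * A ^\<^sub>m j) * A" using Suc by simp
  also have "\<dots> = A * (A ^\<^sub>m j * A)" using A by (intro assoc_mult_mat[of _ n n _ n _ n]) auto
  finally show ?case by simp
qed (use A in simp)

lemma poly_act_pCons:
  fixes A :: "'a :: idom mat"
  assumes A: "A \<in> carrier_mat n n" and v: "v \<in> carrier_vec n"
  shows "poly_act A (pCons a p) v = a \<cdot>\<^sub>v v + A *\<^sub>v poly_act A p v"
proof (rule eq_vecI)
  fix i assume "i < dim_vec (a \<cdot>\<^sub>v v + A *\<^sub>v poly_act A p v)"
  hence i: "i < n" using A by auto
  let ?N = "Suc (degree p)"
  have N: "coeff p j = 0" if "j \<ge> ?N" for j
    using that by (auto intro: coeff_eq_0)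
  have N': "coeff (pCons a p) j = 0" if "j \<ge> Suc ?N" for j
    using that N by (auto simp: coeff_pCons split: nat.splits)
  have pow: "((A ^\<^sub>m Suc j) *\<^sub>v v) $ i = (\<Sum>l<n. A $$ (i, l) * ((A ^\<^sub>m j) *\<^sub>v v) $ l)" for j
  proof -
    have "A ^\<^sub>m Suc j = A * A ^\<^sub>m j" by (rule pow_mat_Suc_left[OF A])
    hence "(A ^\<^sub>m Suc j) *\<^sub>v v = A *\<^sub>v ((A ^\<^sub>m j) *\<^sub>v v)"
      using A v assoc_mult_mat_vec[OF A, of "A ^\<^sub>m j" n v] by simp
    thus ?thesis using A i v
      by (auto simp: scalar_prod_def lessThan_atLeast0 pow_carrier_mat intro!: sum.cong)
  qed
  have "poly_act A (pCons a p) v $ i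
    = a * v $ i + (\<Sum>j<?N. coeff p j * ((A ^\<^sub>m Suc j) *\<^sub>v v) $ i)"
    using poly_act_index[OF A i N', where v = v] A v i
    by (simp only: sum.lessThan_Suc_shift coeff_pCons_0 coeff_pCons_Suc) simp
  also have "(\<Sum>j<?N. coeff p j * ((A ^\<^sub>m Suc j) *\<^sub>v v) $ i)
    = (\<Sum>j<?N. \<Sum>l<n. A $$ (i, l) * (coeff p j * ((A ^\<^sub>m j) *\<^sub>v v) $ l))"
    by (simp only: pow sum_distrib_left mult.left_commute)
  also have "\<dots> = (\<Sum>l<n. \<Sum>j<?N. A $$ (i, l) * (coeff p j * ((A ^\<^sub>m j) *\<^sub>v v) $ l))"
    by (rule sum.swap)
  also have "\<dots> = (\<Sum>l<n. A $$ (i, l) * poly_act A p v $ l)"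
    by (intro sum.cong refl) (simp only: lessThan_iff poly_act_index[OF A _ N] sum_distrib_left)
  also have "\<dots> = (A *\<^sub>v poly_act A p v) $ i"
    using A i poly_act_carrier[OF A, of p v]
    by (auto simp: scalar_prod_def lessThan_atLeast0 intro!: sum.cong)
  finally show "poly_act A (pCons a p) v $ i = (a \<cdot>\<^sub>v v + A *\<^sub>v poly_act A p v) $ i"
    using A v i by simp
qed (use A v poly_act_carrier[OF A, of "pCons a p" v] in auto)

lemma poly_act_mult:
  fixes A :: "'a :: idom mat"
  assumes A: "A \<in> carrier_mat n n" and v: "v \<in> carrier_vec n"
  shows "poly_act A (p * q) v = poly_act A p (poly_act A q v)"
proof (induction p)
  case (pCons a p)
  have "poly_act A (pCons a p * q) v
    = a \<cdot>\<^sub>v poly_act A q v + (0 \<cdot>\<^sub>v v + A *\<^sub>v poly_act A (p * q) v)"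
    by (simp add: poly_act_add_poly[OF A] poly_act_smult[OF A] poly_act_pCons[OF A v])
  also have "0 \<cdot>\<^sub>v v + A *\<^sub>v poly_act A (p * q) v = A *\<^sub>v poly_act A (p * q) v"
    using A v by (simp add: zero_smult_vec[where n = n] left_zero_vec[where n = n])
  finally show ?case
    by (simp add: pCons.IH poly_act_pCons[OF A poly_act_carrier[OF A]])
qed (use A in simp)

lemma poly_act_add:
  fixes A :: "'a :: idom mat"
  assumes A: "A \<in> carrier_mat n n" and v: "v \<in> carrier_vec n" and w: "w \<in> carrier_vec n"
  shows "poly_act A p (v + w) = poly_act A p v + poly_act A p w"
proof (induction p)
  case (pCons a p)
  have A': "A *\<^sub>v poly_act A p (v + w) = A *\<^sub>v poly_act A p v + A *\<^sub>v poly_act A p w"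
    unfolding pCons.IH by (rule mult_add_distrib_mat_vec[OF A]) (simp_all add: poly_act_carrier[OF A])
  have vw: "v + w \<in> carrier_vec n" using v w by simp
  show ?case
    unfolding poly_act_pCons[OF A vw] poly_act_pCons[OF A v] poly_act_pCons[OF A w] A'
    using A v w by (intro eq_vecI) (auto simp del: index_mult_mat_vec simp: distrib_left)
qed (use A in simp)

lemma poly_act_smult_vec:
  fixes A :: "'a :: idom mat"
  assumes A: "A \<in> carrier_mat n n" and v: "v \<in> carrier_vec n"
  shows "poly_act A p (c \<cdot>\<^sub>v v) = c \<cdot>\<^sub>v poly_act A p v"
proof (induction p)
  case (pCons a p)
  have A': "A *\<^sub>v poly_act A p (c \<cdot>\<^sub>v v) = c \<cdot>\<^sub>v (A *\<^sub>v poly_act A p v)"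
    unfolding pCons.IH using A by (intro eq_vecI) (auto simp: scalar_prod_smult_distrib[of _ n])
  have cv: "c \<cdot>\<^sub>v v \<in> carrier_vec n" using v by simp
  show ?case
    unfolding poly_act_pCons[OF A cv] poly_act_pCons[OF A v] A'
    using A v by (intro eq_vecI) (auto simp del: index_mult_mat_vec simp: algebra_simps)
qed (use A in auto)

lemma poly_act_zero_vec [simp]:
  fixes A :: "'a :: idom mat"
  assumes A: "A \<in> carrier_mat n n"
  shows "poly_act A p (0\<^sub>v n) = 0\<^sub>v n"
  using poly_act_smult_vec[OF A zero_carrier_vec, of p 0] A
  by (simp add: zero_smult_vec[where n = n])

lemma poly_act_monom_1:
  fixes A :: "'a :: idom mat"
  assumes A: "A \<in> carrier_mat n n" and v: "v \<in> carrier_vec n"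
  shows "poly_act A (monom 1 j) v = (A ^\<^sub>m j) *\<^sub>v v"
proof (rule eq_vecI)
  fix i assume "i < dim_vec ((A ^\<^sub>m j) *\<^sub>v v)"
  hence i: "i < n" using A by auto
  have "poly_act A (monom 1 j) v $ i
      = (\<Sum>k<Suc j. coeff (monom 1 j) k * ((A ^\<^sub>m k) *\<^sub>v v) $ i)"
    by (rule poly_act_index[OF A i]) auto
  also have "\<dots> = (\<Sum>k<Suc j. if k = j then ((A ^\<^sub>m k) *\<^sub>v v) $ i else 0)"
    by (intro sum.cong) auto
  also have "\<dots> = ((A ^\<^sub>m j) *\<^sub>v v) $ i" by (simp del: sum.lessThan_Suc)
  finally show "poly_act A (monom 1 j) v $ i = ((A ^\<^sub>m j) *\<^sub>v v) $ i" .
qed (use A poly_act_carrier[OF A, of "monom 1 j" v] in auto)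

text \<open>By this duality a polynomial annihilating all vectors under \<open>A\<close> annihilates
  every functional under the transpose of \<open>A\<close>.\<close>

lemma poly_act_transpose:
  fixes A :: "'a :: idom mat"
  assumes A: "A \<in> carrier_mat n n" and f: "f \<in> carrier_vec n" and v: "v \<in> carrier_vec n"
  shows "poly_act (A\<^sup>T) p f \<bullet> v = f \<bullet> poly_act A p v"
  using v
proof (induction p arbitrary: v)
  case 0
  have "A\<^sup>T \<in> carrier_mat n n" using A by simp
  thus ?case using A f 0 by (simp add: poly_act_0[of A n] poly_act_0[of "A\<^sup>T" n])
next
  case (pCons a p)
  note v = pCons.prems
  have At: "A\<^sup>T \<in> carrier_mat n n" and Av: "A *\<^sub>v v \<in> carrier_vec n" using A v mult_mat_vec_carrier by simp_all
  have "A *\<^sub>v poly_act A p v = poly_act A (pCons 0 p) v"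
    unfolding poly_act_pCons[OF A v] using A v by (intro eq_vecI) auto
  also have "pCons 0 p = p * [:0, 1:]" by simp
  also have "poly_act A (p * [:0, 1:]) v = poly_act A p (poly_act A [:0, 1:] v)"
    by (rule poly_act_mult[OF A v])
  also have "poly_act A [:0, 1:] v = A *\<^sub>v v"
  proof -
    have "A *\<^sub>v 0\<^sub>v n = 0\<^sub>v n" using A by (intro eq_vecI) auto
    thus ?thesis unfolding poly_act_pCons[OF A v] poly_act_0[OF A] using A v
      by (simp add: zero_smult_vec[where n = n] left_zero_vec[where n = n]
          right_zero_vec[where n = n])
  qed
  finally have comm: "A *\<^sub>v poly_act A p v = poly_act A p (A *\<^sub>v v)" .
  have "(A\<^sup>T *\<^sub>v poly_act (A\<^sup>T) p f) \<bullet> v = poly_act (A\<^sup>T) p f \<bullet> (A *\<^sub>v v)"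
    by (rule transpose_vec_mult_scalar[OF A v poly_act_carrier[OF At]])
  also have "\<dots> = f \<bullet> (A *\<^sub>v poly_act A p v)"
    using pCons.IH[OF Av] comm by simp
  finally have E: "(A\<^sup>T *\<^sub>v poly_act (A\<^sup>T) p f) \<bullet> v = f \<bullet> (A *\<^sub>v poly_act A p v)" .
  have c1: "A\<^sup>T *\<^sub>v poly_act (A\<^sup>T) p f \<in> carrier_vec n" "A *\<^sub>v poly_act A p v \<in> carrier_vec n"
    using mult_mat_vec_carrier[OF At poly_act_carrier[OF At]]
      mult_mat_vec_carrier[OF A poly_act_carrier[OF A]] .
  have c2: "a \<cdot>\<^sub>v f \<in> carrier_vec n" "a \<cdot>\<^sub>v v \<in> carrier_vec n" using f v by simp_all
  show ?case
    unfolding poly_act_pCons[OF A v] poly_act_pCons[OF At f]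
      add_scalar_prod_distrib[OF c2(1) c1(1) v] scalar_prod_add_distrib[OF f c2(2) c1(2)] E
      smult_scalar_prod_distrib[OF f v] scalar_prod_smult_distrib[OF f v] ..
qed

lemma ex_poly_of_coeff_vec:
  assumes c: "c \<in> carrier_vec N"
  obtains p where "vec N (coeff p) = c" "\<And>j. j \<ge> N \<Longrightarrow> coeff p j = 0"
proof -
  define p where "p = Poly (list_of_vec c)"
  have "coeff p j = (if j < N then c $ j else 0)" for j
    using c by (auto simp: p_def nth_default_def list_of_vec_index)
  moreover from this have "vec N (coeff p) = c" using c by (intro eq_vecI) auto
  ultimately show ?thesis using that[of p] by simp
qed

subsection \<open>Vectors with maximal local minimal polynomial\<close>

text \<open>The \<open>n + 1\<close> vectors \<open>v, A v, \<dots>, A\<^sup>n v\<close> lie in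
  dimension \<open>n\<close> and are therefore dependent.\<close>

lemma ex_local_annihilator:
  fixes A :: "'a :: field mat"
  assumes A: "A \<in> carrier_mat n n"
  shows "\<exists>p. p \<noteq> 0 \<and> poly_act A p v = 0\<^sub>v n"
proof -
  have K: "krylov (Suc n) A v \<in> carrier_mat n (Suc n)" using A by (rule krylov_carrier)
  obtain c where c: "c \<in> carrier_vec (Suc n)" "c \<noteq> 0\<^sub>v (Suc n)" "krylov (Suc n) A v *\<^sub>v c = 0\<^sub>v n"
    using wide_matrix_kernel[OF K] by blast
  obtain p where p: "vec (Suc n) (coeff p) = c" "\<And>j. j \<ge> Suc n \<Longrightarrow> coeff p j = 0"
    using ex_poly_of_coeff_vec[OF c(1)] by blast
  have "p \<noteq> 0" using c(2) p(1) by (auto simp: zero_vec_def)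
  moreover have "poly_act A p v = 0\<^sub>v n"
    using poly_act_eq_krylov[OF A p(2)] p(1) c(3) by simp
  ultimately show ?thesis by blast
qed

text \<open>A product of local annihilators of the unit vectors works, since polynomials in
  \<open>A\<close> commute. The induction treats vectors supported on the first \<open>k\<close>
  coordinates.\<close>

lemma ex_annihilator:
  fixes A :: "'a :: field mat"
  assumes A: "A \<in> carrier_mat n n"
  obtains p where "p \<noteq> 0" "\<And>v. v \<in> carrier_vec n \<Longrightarrow> poly_act A p v = 0\<^sub>v n"
proof -
  have "\<exists>p. p \<noteq> 0 \<and> (\<forall>v \<in> carrier_vec n. (\<forall>i. k \<le> i \<longrightarrow> i < n \<longrightarrow> v $ i = 0) \<longrightarrow> poly_act A p v = 0\<^sub>v n)"
    for k
  proof (induction k)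
    case 0
    have "v = 0\<^sub>v n" if "v \<in> carrier_vec n" "\<forall>i. 0 \<le> i \<longrightarrow> i < n \<longrightarrow> v $ i = 0" for v :: "'a vec"
      using that by (intro eq_vecI) auto
    thus ?case using poly_act_zero_vec[OF A] by (intro exI[of _ 1]) auto
  next
    case (Suc k)
    then obtain p where p: "p \<noteq> 0"
      "\<And>v. v \<in> carrier_vec n \<Longrightarrow> (\<forall>i. k \<le> i \<longrightarrow> i < n \<longrightarrow> v $ i = 0) \<Longrightarrow> poly_act A p v = 0\<^sub>v n"
      by blast
    obtain q where q: "q \<noteq> 0" "poly_act A q (unit_vec n k) = 0\<^sub>v n"
      using ex_local_annihilator[OF A] by blast
    show ?case
    proof (intro exI conjI ballI impI)
      show "p * q \<noteq> 0" using p q by simp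
      fix v :: "'a vec"
      assume v: "v \<in> carrier_vec n" and z: "\<forall>i. Suc k \<le> i \<longrightarrow> i < n \<longrightarrow> v $ i = 0"
      let ?e = "unit_vec n k :: 'a vec"
      \<comment> \<open>Here \<open>k\<close> runs over all naturals; the default 0 beyond the
        dimension makes \<open>u = v\<close> there.\<close>
      define c where "c = (if k < n then v $ k else 0)"
      define u where "u = v - c \<cdot>\<^sub>v ?e"
      have u: "u \<in> carrier_vec n" using v by (simp add: u_def)
      have "u $ i = 0" if "k \<le> i" "i < n" for i
        using that z v by (cases "i = k") (auto simp: u_def c_def)
      hence pu: "poly_act A p u = 0\<^sub>v n" using p(2) u by blast
      have "v = u + c \<cdot>\<^sub>v ?e" using v by (auto simp: u_def intro!: eq_vecI)
      hence "poly_act A (p * q) v = poly_act A (p * q) u + poly_act A (p * q) (c \<cdot>\<^sub>v ?e)"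
        using poly_act_add[OF A u, of "c \<cdot>\<^sub>v ?e" "p * q"] by simp
      also have "poly_act A (p * q) u = poly_act A (q * p) u" by (simp only: mult.commute)
      also have "\<dots> = 0\<^sub>v n"
        using A by (simp add: poly_act_mult[OF A u] pu)
      also have "poly_act A (p * q) (c \<cdot>\<^sub>v ?e) = c \<cdot>\<^sub>v poly_act A p (poly_act A q ?e)"
        using poly_act_smult_vec[OF A, of ?e] poly_act_mult[OF A, of ?e] by simp
      also have "\<dots> = 0\<^sub>v n" using A q(2) by auto
      finally show "poly_act A (p * q) v = 0\<^sub>v n" by simp
    qed
  qed
  from this[of n] that show ?thesis by auto
qed

text \<open>The annihilator of \<open>v\<close> is an ideal, and division with remainder shows that
  a nonzero member of least degree generates it. The monic generator is chosen so that the possible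
  values can be counted later.\<close>

lemma local_minimal_poly:
  fixes A :: "'a :: field mat"
  assumes A: "A \<in> carrier_mat n n" and v: "v \<in> carrier_vec n"
  shows "\<exists>q. monic q \<and> poly_act A q v = 0\<^sub>v n \<and> (\<forall>r. poly_act A r v = 0\<^sub>v n \<longrightarrow> q dvd r)"
proof -
  define P where "P = (\<lambda>r. r \<noteq> 0 \<and> poly_act A r v = 0\<^sub>v n)"
  have "\<exists>r. P r" using ex_local_annihilator[OF A] by (auto simp: P_def)
  then obtain q where q: "P q" and min: "\<And>r. P r \<Longrightarrow> degree q \<le> degree r"
    using ex_has_least_nat[of P _ degree] by blast
  let ?q = "smult (inverse (lead_coeff q)) q"
  have q0: "q \<noteq> 0" "poly_act A q v = 0\<^sub>v n" using q by (auto simp: P_def)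
  have "monic ?q" using q0 by simp
  moreover have "poly_act A ?q v = 0\<^sub>v n"
    using q0 by (auto simp: poly_act_smult[OF A])
  moreover have "?q dvd r" if r: "poly_act A r v = 0\<^sub>v n" for r
  proof -
    have "poly_act A r v = poly_act A (r div q * q + r mod q) v" by simp
    also have "\<dots> = poly_act A (r mod q) v"
      using A q0 poly_act_carrier[OF A, of "r mod q" v]
      by (simp only: poly_act_add_poly[OF A] poly_act_mult[OF A v] poly_act_zero_vec left_zero_vec)
    finally have "poly_act A (r mod q) v = 0\<^sub>v n" using r by simp
    hence "r mod q = 0"
      using min[of "r mod q"] degree_mod_less[of q r] q0 by (force simp: P_def)
    hence "q dvd r" by blast
    thus ?thesis using q0 by (simp add: smult_dvd_iff)
  qed
  ultimately show ?thesis by blast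
qed

lemma finite_submultisets: "finite {F. F \<subseteq># M}"
proof (rule finite_surj)
  show "finite {xs. set xs \<subseteq> set_mset M \<and> length xs \<le> size M}"
    by (rule finite_lists_length_le) simp
  show "{F. F \<subseteq># M} \<subseteq> mset ` {xs. set xs \<subseteq> set_mset M \<and> length xs \<le> size M}"
  proof
    fix F assume F: "F \<in> {F. F \<subseteq># M}"
    obtain xs where "F = mset xs" using ex_mset[of F] by metis
    with F show "F \<in> mset ` {xs. set xs \<subseteq> set_mset M \<and> length xs \<le> size M}"
      using set_mset_mono[of F M] size_mset_mono[of F M] by auto
  qed
qed

text \<open>A nonzero polynomial is determined up to a unit by its prime factorization, monicity
  removes the unit, and divisors of \<open>p\<close> give submultisets of the factorization of
  \<open>p\<close>.\<close>

lemma finite_monic_divisors: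
  fixes p :: "'a :: field_gcd poly"
  assumes "p \<noteq> 0"
  shows "finite {q. monic q \<and> q dvd p}"
proof -
  have "inj_on prime_factorization {q. monic q \<and> q dvd p}"
  proof (rule inj_onI)
    fix q r :: "'a poly"
    assume *: "q \<in> {q. monic q \<and> q dvd p}" "r \<in> {q. monic q \<and> q dvd p}"
      and eq: "prime_factorization q = prime_factorization r"
    from * have "q \<noteq> 0" "r \<noteq> 0" by auto
    with eq have "normalize q = normalize r"
      using prime_factorization_unique by blast
    with * show "q = r" by (simp add: normalize_monic)
  qed
  moreover have "prime_factorization ` {q. monic q \<and> q dvd p} \<subseteq> {F. F \<subseteq># prime_factorization p}"
    using assms by (auto simp: prime_factorization_subset_iff_dvd)
  ultimately show ?thesis
    using finite_subset[OF _ finite_submultisets] finite_image_iff by blast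
qed

text \<open>
  Among the vectors \<open>w + t v\<close> two have the same local minimal polynomial, since these are monic
  divisors of one fixed polynomial; it then annihilates both \<open>w\<close> and \<open>v\<close>. Choosing \<open>w\<close> with
  local minimal polynomial of maximal degree, it must be that of \<open>w\<close>.
\<close>
lemma ex_maximal_vector:
  fixes A :: "'a :: field_gcd mat"
  assumes A: "A \<in> carrier_mat n n" and inf: "infinite (UNIV :: 'a set)"
  obtains w q where "w \<in> carrier_vec n" "monic q"
    "\<And>v. v \<in> carrier_vec n \<Longrightarrow> poly_act A q v = 0\<^sub>v n"
    "\<And>r. poly_act A r w = 0\<^sub>v n \<Longrightarrow> q dvd r"
proof -
  obtain m where m: "m \<noteq> 0" "\<And>v. v \<in> carrier_vec n \<Longrightarrow> poly_act A m v = 0\<^sub>v n"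
    using ex_annihilator[OF A] by blast
  obtain \<mu> where "\<forall>v \<in> carrier_vec n. monic (\<mu> v) \<and> poly_act A (\<mu> v) v = 0\<^sub>v n \<and>
      (\<forall>r. poly_act A r v = 0\<^sub>v n \<longrightarrow> \<mu> v dvd r)"
    using bchoice[of "carrier_vec n"] local_minimal_poly[OF A] by metis
  hence \<mu>: "\<And>v. v \<in> carrier_vec n \<Longrightarrow> monic (\<mu> v)"
    "\<And>v. v \<in> carrier_vec n \<Longrightarrow> poly_act A (\<mu> v) v = 0\<^sub>v n"
    "\<And>v r. v \<in> carrier_vec n \<Longrightarrow> poly_act A r v = 0\<^sub>v n \<Longrightarrow> \<mu> v dvd r"
    by blast+
  have dvd_m: "\<mu> v dvd m" if "v \<in> carrier_vec n" for v using \<mu> m that by blast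
  \<comment> \<open>The degrees are bounded since every local minimal polynomial divides
    \<open>m\<close>; the zero vector shows that there is a candidate.\<close>
  have "\<exists>w. w \<in> carrier_vec n \<and> (\<forall>v. v \<in> carrier_vec n \<longrightarrow> degree (\<mu> v) \<le> degree (\<mu> w))"
  proof (rule ex_has_greatest_nat[where k = "0\<^sub>v n" and b = "Suc (degree m)"])
    show "\<forall>v. v \<in> carrier_vec n \<longrightarrow> degree (\<mu> v) < Suc (degree m)"
      using dvd_imp_degree_le[OF dvd_m m(1)] by (simp add: less_Suc_eq_le)
  qed simp
  then obtain w where w: "w \<in> carrier_vec n"
    and max: "\<And>v. v \<in> carrier_vec n \<Longrightarrow> degree (\<mu> v) \<le> degree (\<mu> w)" by blast
  have "poly_act A (\<mu> w) v = 0\<^sub>v n" if v: "v \<in> carrier_vec n" for v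
  proof -
    have wt: "w + t \<cdot>\<^sub>v v \<in> carrier_vec n" for t using w v by simp
    have "finite (range (\<lambda>t. \<mu> (w + t \<cdot>\<^sub>v v)))"
      by (rule finite_subset[OF _ finite_monic_divisors[OF m(1)]]) (use \<mu> dvd_m wt in blast)
    hence "\<not> inj (\<lambda>t. \<mu> (w + t \<cdot>\<^sub>v v))"
      using inf finite_imageD by blast
    then obtain s t where st: "s \<noteq> t" "\<mu> (w + s \<cdot>\<^sub>v v) = \<mu> (w + t \<cdot>\<^sub>v v)"
      by (auto simp: inj_def)
    define q where "q = \<mu> (w + t \<cdot>\<^sub>v v)"
    have act: "poly_act A q (w + x \<cdot>\<^sub>v v) = poly_act A q w + x \<cdot>\<^sub>v poly_act A q v" for x
      using poly_act_add[OF A w, of "x \<cdot>\<^sub>v v" q] poly_act_smult_vec[OF A v, of q x] v by simp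
    have zero: "poly_act A q w + s \<cdot>\<^sub>v poly_act A q v = 0\<^sub>v n"
      "poly_act A q w + t \<cdot>\<^sub>v poly_act A q v = 0\<^sub>v n"
      using \<mu>(2)[OF wt, of s] \<mu>(2)[OF wt, of t] st(2) act by (simp_all add: q_def)
    \<comment> \<open>Subtracting the two relations gives \<open>(s - t) q(A) v = 0\<close>, and
      then \<open>q(A) w = 0\<close>.\<close>
    have qvi: "poly_act A q v $ i = 0 \<and> poly_act A q w $ i = 0" if "i < n" for i
    proof -
      have "poly_act A q w $ i + s * poly_act A q v $ i = 0"
        "poly_act A q w $ i + t * poly_act A q v $ i = 0"
        using arg_cong[OF zero(1), of "\<lambda>v. v $ i"] arg_cong[OF zero(2), of "\<lambda>v. v $ i"] that A
        by simp_all
      moreover from this have "s * poly_act A q v $ i = t * poly_act A q v $ i"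
        by (metis add_left_cancel)
      ultimately show ?thesis using st(1) by simp
    qed
    have qv: "poly_act A q v = 0\<^sub>v n" "poly_act A q w = 0\<^sub>v n"
      using qvi A by (auto intro!: eq_vecI)
    \<comment> \<open>Since \<open>\<mu> w\<close> divides \<open>q\<close> and maximality bounds
      the degree of \<open>q\<close>, the cofactor is constant; it is 1 because both are
      monic.\<close>
    have "\<mu> w dvd q" using \<mu>(3)[OF w qv(2)] .
    moreover have "monic q" "degree q \<le> degree (\<mu> w)"
      using \<mu>(1)[OF wt] max[OF wt] by (auto simp: q_def)
    ultimately obtain r where r: "q = \<mu> w * r" and "r \<noteq> 0" "\<mu> w \<noteq> 0"
      by (metis dvdE leading_coeff_0_iff mult_zero_left mult_zero_right zero_neq_one)
    have "degree q = degree (\<mu> w) + degree r"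
      using r \<open>r \<noteq> 0\<close> \<open>\<mu> w \<noteq> 0\<close> by (simp add: degree_mult_eq)
    hence "degree r = 0" using \<open>degree q \<le> degree (\<mu> w)\<close> by simp
    then obtain c where "r = [:c:]" by (rule degree_eq_zeroE)
    moreover have "lead_coeff r = 1"
      using \<open>monic q\<close> \<mu>(1)[OF w] by (simp add: r lead_coeff_mult)
    ultimately have "r = 1" by (simp add: one_pCons)
    thus ?thesis using r qv by simp
  qed
  with that[OF w \<mu>(1)[OF w]] \<mu>(3)[OF w] show ?thesis by blast
qed

subsection \<open>A cyclic vector for the commutant\<close>

text \<open>For monic \<open>q\<close> this is multiplication by the variable modulo
  \<open>q\<close>, in the basis of powers below the degree.\<close>

definition companion_mat :: "'a :: comm_ring_1 poly \<Rightarrow> 'a mat" where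
  "companion_mat q = mat (degree q) (degree q)
     (\<lambda>(i, j). if Suc j < degree q then (if i = Suc j then 1 else 0) else - coeff q i)"

text \<open>Multiplication by \<open>A\<close> shifts the columns \<open>A\<^sup>j v\<close> by one;
  the overflow in the last column is rewritten by \<open>q(A) v = 0\<close>.\<close>

lemma krylov_companion:
  fixes A :: "'a :: idom mat"
  assumes A: "A \<in> carrier_mat n n" and v: "v \<in> carrier_vec n"
    and q: "monic q" "poly_act A q v = 0\<^sub>v n"
  shows "A * krylov (degree q) A v = krylov (degree q) A v * companion_mat q"
proof (rule eq_matI)
  let ?d = "degree q"
  fix i j assume "i < dim_row (krylov ?d A v * companion_mat q)"
    "j < dim_col (krylov ?d A v * companion_mat q)"
  hence i: "i < n" and j: "j < ?d" using A by (auto simp: companion_mat_def)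
  have col: "col (krylov ?d A v) j = (A ^\<^sub>m j) *\<^sub>v v"
    using A j by (intro eq_vecI) (auto simp: krylov_def)
  have "(A * krylov ?d A v) $$ (i, j) = (A *\<^sub>v col (krylov ?d A v) j) $ i"
    using A i j by simp
  also have "A *\<^sub>v col (krylov ?d A v) j = (A ^\<^sub>m Suc j) *\<^sub>v v"
    unfolding col pow_mat_Suc_left[OF A] using A v
    by (intro assoc_mult_mat_vec[symmetric]) auto
  finally have L: "(A * krylov ?d A v) $$ (i, j) = ((A ^\<^sub>m Suc j) *\<^sub>v v) $ i" .
  have R: "(krylov ?d A v * companion_mat q) $$ (i, j) =
      (\<Sum>k<?d. ((A ^\<^sub>m k) *\<^sub>v v) $ i * companion_mat q $$ (k, j))"
    using A i j
    by (auto simp: scalar_prod_def krylov_def companion_mat_def lessThan_atLeast0 intro!: sum.cong)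
  show "(A * krylov ?d A v) $$ (i, j) = (krylov ?d A v * companion_mat q) $$ (i, j)"
  proof (cases "Suc j < ?d")
    case True
    have "(\<Sum>k<?d. ((A ^\<^sub>m k) *\<^sub>v v) $ i * companion_mat q $$ (k, j)) =
        (\<Sum>k<?d. if k = Suc j then ((A ^\<^sub>m k) *\<^sub>v v) $ i else 0)"
      using True j by (intro sum.cong) (auto simp: companion_mat_def)
    thus ?thesis using L R True by (simp only: sum.delta finite_lessThan lessThan_iff if_True)
  next
    case False
    hence d: "?d = Suc j" using j by simp
    have "0 = poly_act A q v $ i" using q(2) i by simp
    also have "\<dots> = (\<Sum>k<Suc ?d. coeff q k * ((A ^\<^sub>m k) *\<^sub>v v) $ i)"
      by (rule poly_act_index[OF A i]) (simp add: coeff_eq_0)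
    also have "\<dots> = (\<Sum>k<?d. coeff q k * ((A ^\<^sub>m k) *\<^sub>v v) $ i) + ((A ^\<^sub>m ?d) *\<^sub>v v) $ i"
      using q(1) by simp
    finally have "((A ^\<^sub>m ?d) *\<^sub>v v) $ i = - (\<Sum>k<?d. coeff q k * ((A ^\<^sub>m k) *\<^sub>v v) $ i)"
      by (simp add: eq_neg_iff_add_eq_0 add.commute)
    also have "\<dots> = (\<Sum>k<?d. ((A ^\<^sub>m k) *\<^sub>v v) $ i * companion_mat q $$ (k, j))"
      unfolding sum_negf[symmetric]
      using False j by (intro sum.cong) (auto simp: companion_mat_def)
    finally show ?thesis using L R d by simp
  qed
qed (use A in \<open>auto simp: companion_mat_def\<close>)

text \<open>
  With \<open>d\<close> the degree of the minimal polynomial, take \<open>w\<close> such that \<open>w, A w, \<dots>, A\<^sup>d\<^sup>-\<^sup>1 w\<close> are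
  independent, a functional \<open>f\<close> with \<open>f (A\<^sup>i w) = (if i = d - 1 then 1 else 0)\<close>, and let
  \<open>K\<^sub>x = [x, A x, \<dots>, A\<^sup>d\<^sup>-\<^sup>1 x]\<close> and \<open>W\<close> be the matrix with rows \<open>f A\<^sup>i\<close>. Then
  \<open>A K\<^sub>x = K\<^sub>x N\<close> and \<open>W A = N\<^sup>T W\<close> for the companion matrix \<open>N\<close>, the Hankel matrix \<open>H = W K\<^sub>w\<close> is
  invertible, \<open>C = K\<^sub>x H\<^sup>-\<^sup>1 W\<close> commutes with \<open>A\<close> since \<open>H N = N\<^sup>T H\<close>, and it maps \<open>w\<close> to \<open>x\<close>.
\<close>
lemma commutant_cyclic_vector:
  fixes A :: "'a :: {conjugatable_ordered_field, field_gcd} mat"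
  assumes A: "A \<in> carrier_mat n n" and inf: "infinite (UNIV :: 'a set)"
  obtains w where "w \<in> carrier_vec n"
    "\<And>x. x \<in> carrier_vec n \<Longrightarrow> \<exists>C \<in> carrier_mat n n. C * A = A * C \<and> C *\<^sub>v w = x"
proof -
  obtain w q where w: "w \<in> carrier_vec n" and mq: "monic q"
    and ann: "\<And>v. v \<in> carrier_vec n \<Longrightarrow> poly_act A q v = 0\<^sub>v n"
    and dvd: "\<And>r. poly_act A r w = 0\<^sub>v n \<Longrightarrow> q dvd r"
    by (rule ex_maximal_vector[OF A inf]) blast
  define d where "d = degree q"
  have "\<exists>C \<in> carrier_mat n n. C * A = A * C \<and> C *\<^sub>v w = x" if x: "x \<in> carrier_vec n" for x
  proof (cases "d = 0")
    \<comment> \<open>Now \<open>q = 1\<close> annihilates every vector, so the space is zero and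
      the identity matrix serves.\<close>
    case True
    with mq have "q = 1" by (simp add: d_def monic_degree_0)
    have "v = 0\<^sub>v n" if v: "v \<in> carrier_vec n" for v :: "'a vec"
    proof -
      have "poly_act A 1 v = (A ^\<^sub>m 0) *\<^sub>v v"
        using poly_act_monom_1[OF A v, of 0] by (simp add: monom_0 one_pCons)
      thus ?thesis using ann[OF v] \<open>q = 1\<close> A v by simp
    qed
    from this[OF x] this[OF w] show ?thesis using A by (intro bexI[of _ "1\<^sub>m n"]) auto
  next
    case False
    let ?K = "krylov d A" and ?N = "companion_mat q"
    have K: "?K v \<in> carrier_mat n d" for v using A by simp
    have N: "?N \<in> carrier_mat d d" by (simp add: companion_mat_def d_def)
    \<comment> \<open>A relation among the columns is a polynomial of degree below \<open>d\<close>
      annihilating \<open>w\<close>; being a multiple of \<open>q\<close>, it is zero.\<close>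
    have ker: "c = 0\<^sub>v d" if c: "c \<in> carrier_vec d" "?K w *\<^sub>v c = 0\<^sub>v n" for c
    proof -
      obtain p where p: "vec d (coeff p) = c" "\<And>j. j \<ge> d \<Longrightarrow> coeff p j = 0"
        using ex_poly_of_coeff_vec[OF c(1)] by blast
      have "q dvd p" using dvd poly_act_eq_krylov[OF A p(2)] p(1) c(2) by simp
      hence "p = 0"
        using p(2)[of "degree p"] dvd_imp_degree_le[of q p] by (auto simp: d_def)
      thus ?thesis using p(1) by (auto intro!: eq_vecI)
    qed
    obtain V where V: "V \<in> carrier_mat d n" "V * ?K w = 1\<^sub>m d"
      using trivial_kernel_imp_left_inverse[OF K ker] .
    \<comment> \<open>The last row of a left inverse of \<open>?K w\<close> reads off the
      coefficient of the top power \<open>A\<^sup>d\<^sup>-\<^sup>1 w\<close>.\<close>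
    define f where "f = row V (d - 1)"
    have f: "f \<in> carrier_vec n" using V(1) by (intro carrier_vecI) (simp add: f_def)
    have fK: "f \<bullet> (?K w *\<^sub>v c) = c $ (d - 1)" if c: "c \<in> carrier_vec d" for c
    proof -
      have "f \<bullet> (?K w *\<^sub>v c) = (V *\<^sub>v (?K w *\<^sub>v c)) $ (d - 1)"
        using V(1) False by (simp add: f_def)
      also have "V *\<^sub>v (?K w *\<^sub>v c) = c"
        using assoc_mult_mat_vec[OF V(1) K c, symmetric] V(2) c by simp
      finally show ?thesis .
    qed
    have At: "A\<^sup>T \<in> carrier_mat n n" using A by simp
    define W where "W = (krylov d (A\<^sup>T) f)\<^sup>T"
    have Kt: "krylov d (A\<^sup>T) f \<in> carrier_mat n d" using At by simp
    have W: "W \<in> carrier_mat d n" using Kt by (simp add: W_def)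
    have W_index: "(W *\<^sub>v u) $ i = f \<bullet> ((A ^\<^sub>m i) *\<^sub>v u)" if "i < d" "u \<in> carrier_vec n" for i u
    proof -
      have "row W i = poly_act (A\<^sup>T) (monom 1 i) f"
        using that(1) Kt A unfolding poly_act_monom_1[OF At f]
        by (intro eq_vecI) (auto simp: W_def krylov_def)
      hence "(W *\<^sub>v u) $ i = poly_act (A\<^sup>T) (monom 1 i) f \<bullet> u"
        using that(1) W by simp
      also have "\<dots> = f \<bullet> ((A ^\<^sub>m i) *\<^sub>v u)"
        by (simp add: poly_act_transpose[OF A f that(2)] poly_act_monom_1[OF A that(2)])
      finally show ?thesis .
    qed
    \<comment> \<open>Duality moves the annihilation by \<open>q\<close> to the transpose, so the
      Krylov matrix of \<open>f\<close> obeys the same companion relation; transposing it gives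
      \<open>WA\<close>.\<close>
    have "poly_act (A\<^sup>T) q f = 0\<^sub>v n"
    proof (rule eq_vecI)
      fix i assume "i < dim_vec (0\<^sub>v n :: 'a vec)"
      hence i: "i < n" by simp
      have "poly_act (A\<^sup>T) q f $ i = poly_act (A\<^sup>T) q f \<bullet> unit_vec n i"
        using i scalar_prod_right_unit[of i n "poly_act (A\<^sup>T) q f"] poly_act_carrier[OF At]
        by simp
      also have "\<dots> = 0"
        using poly_act_transpose[OF A f, of "unit_vec n i" q] ann[of "unit_vec n i"] f by simp
      finally show "poly_act (A\<^sup>T) q f $ i = 0\<^sub>v n $ i" using i by simp
    qed (use A in simp)
    from krylov_companion[OF At f mq this]
    have "(A\<^sup>T * krylov d (A\<^sup>T) f)\<^sup>T = (krylov d (A\<^sup>T) f * ?N)\<^sup>T" by (simp add: d_def)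
    hence WA: "W * A = ?N\<^sup>T * W"
      using transpose_mult[OF At Kt] transpose_mult[OF Kt N] by (simp add: W_def)
    have AK: "A * ?K v = ?K v * ?N" if "v \<in> carrier_vec n" for v
      using krylov_companion[OF A that mq ann[OF that]] by (simp add: d_def)
    define H where "H = W * ?K w"
    have H: "H \<in> carrier_mat d d" using mult_carrier_mat[OF W K] by (simp add: H_def)
    have HN: "H * ?N = ?N\<^sup>T * H"
    proof -
      have "H * ?N = W * (?K w * ?N)" unfolding H_def by (rule assoc_mult_mat[OF W K N])
      also have "\<dots> = (W * A) * ?K w"
        unfolding AK[OF w, symmetric] by (rule assoc_mult_mat[OF W A K, symmetric])
      also have "\<dots> = ?N\<^sup>T * H"
        unfolding WA H_def by (rule assoc_mult_mat[OF transpose_carrier_mat[THEN iffD2, OF N] W K])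
      finally show ?thesis .
    qed
    have "c = 0\<^sub>v d" if c: "c \<in> carrier_vec d" "H *\<^sub>v c = 0\<^sub>v d" for c
    proof (rule ccontr)
      assume "c \<noteq> 0\<^sub>v d"
      obtain p where p: "vec d (coeff p) = c" "\<And>j. j \<ge> d \<Longrightarrow> coeff p j = 0"
        using ex_poly_of_coeff_vec[OF c(1)] by blast
      have "p \<noteq> 0" using \<open>c \<noteq> 0\<^sub>v d\<close> p(1) by (auto simp: zero_vec_def)
      hence deg: "degree p < d" using p(2)[of "degree p"] by force
      \<comment> \<open>This shift moves the leading term of \<open>p\<close> to degree
        \<open>d - 1\<close>, where \<open>f\<close> reads it; so entry \<open>i\<close> of
        \<open>H *\<^sub>v c\<close> is the leading coefficient of \<open>p\<close>.\<close>
      define i where "i = d - 1 - degree p"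
      have i: "i + degree p = d - 1" "i < d" using deg by (auto simp: i_def)
      let ?u = "poly_act A p w"
      have u: "?u \<in> carrier_vec n" using A by simp
      have "W *\<^sub>v ?u = H *\<^sub>v c"
        using poly_act_eq_krylov[OF A p(2)] p(1) assoc_mult_mat_vec[OF W K c(1)]
        by (simp add: H_def)
      hence "0 = f \<bullet> ((A ^\<^sub>m i) *\<^sub>v ?u)"
        using W_index[OF i(2) u] c(2) i(2) by simp
      also have "(A ^\<^sub>m i) *\<^sub>v ?u = poly_act A (monom 1 i * p) w"
        by (simp only: poly_act_mult[OF A w] poly_act_monom_1[OF A u])
      also have "\<dots> = ?K w *\<^sub>v vec d (coeff (monom 1 i * p))"
      proof (rule poly_act_eq_krylov[OF A])
        fix j assume "j \<ge> d"
        thus "coeff (monom 1 i * p) j = 0"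
          using i deg by (auto simp: coeff_monom_mult intro!: coeff_eq_0)
      qed
      also have "f \<bullet> \<dots> = lead_coeff p"
      proof -
        have "d - Suc i = degree p" using i by simp
        thus ?thesis
          using fK[of "vec d (coeff (monom 1 i * p))"] False i by (simp add: coeff_monom_mult)
      qed
      finally show False using \<open>p \<noteq> 0\<close> by simp
    qed
    then obtain G where G: "G \<in> carrier_mat d d" "G * H = 1\<^sub>m d" "H * G = 1\<^sub>m d"
      using trivial_kernel_imp_invertible[OF H] by blast
    have NG: "?N * G = G * ?N\<^sup>T"
    proof -
      have Nt: "?N\<^sup>T \<in> carrier_mat d d" using N by simp
      have "?N * G = (G * H) * (?N * G)" using G N by simp
      also have "\<dots> = G * (H * (?N * G))"
        by (rule assoc_mult_mat[OF G(1) H mult_carrier_mat[OF N G(1)]])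
      also have "H * (?N * G) = (?N\<^sup>T * H) * G"
        unfolding HN[symmetric] by (rule assoc_mult_mat[OF H N G(1), symmetric])
      also have "\<dots> = ?N\<^sup>T"
        using assoc_mult_mat[OF Nt H G(1)] G Nt by simp
      finally show ?thesis .
    qed
    define C where "C = ?K x * (G * W)"
    have GW: "G * W \<in> carrier_mat d n" using mult_carrier_mat[OF G(1) W] .
    have C: "C \<in> carrier_mat n n" using mult_carrier_mat[OF K GW] by (simp add: C_def)
    have "C * A = ?K x * ((G * W) * A)" unfolding C_def by (rule assoc_mult_mat[OF K GW A])
    also have "(G * W) * A = G * (?N\<^sup>T * W)"
      unfolding WA[symmetric] by (rule assoc_mult_mat[OF G(1) W A])
    also have "\<dots> = (?N * G) * W"
      unfolding NG by (rule assoc_mult_mat[OF G(1) transpose_carrier_mat[THEN iffD2, OF N] W, symmetric])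
    also have "\<dots> = ?N * (G * W)" by (rule assoc_mult_mat[OF N G(1) W])
    also have "?K x * \<dots> = (A * ?K x) * (G * W)"
      unfolding AK[OF x] by (rule assoc_mult_mat[OF K N GW, symmetric])
    also have "\<dots> = A * C" unfolding C_def by (rule assoc_mult_mat[OF A K GW])
    finally have comm: "C * A = A * C" .
    have first: "?K v *\<^sub>v unit_vec d 0 = v" if "v \<in> carrier_vec n" for v
    proof (rule eq_vecI)
      fix i assume "i < dim_vec v"
      thus "(?K v *\<^sub>v unit_vec d 0) $ i = v $ i"
        using that A False by (simp add: krylov_def)
    qed (use that A in simp)
    \<comment> \<open>The vector \<open>w\<close> is column 0 of \<open>?K w\<close>, the inner
      product of matrices collapses to \<open>G * H\<close>, and column 0 of \<open>?K x\<close> is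
      \<open>x\<close>.\<close>
    have "C *\<^sub>v w = ?K x *\<^sub>v ((G * W) *\<^sub>v (?K w *\<^sub>v unit_vec d 0))"
      unfolding first[OF w] C_def by (rule assoc_mult_mat_vec[OF K GW w])
    also have "(G * W) *\<^sub>v (?K w *\<^sub>v unit_vec d 0) = ((G * W) * ?K w) *\<^sub>v unit_vec d 0"
      by (rule assoc_mult_mat_vec[OF GW K, symmetric]) simp
    also have "(G * W) * ?K w = 1\<^sub>m d"
      using assoc_mult_mat[OF G(1) W K] G(2) by (simp add: H_def)
    also have "?K x *\<^sub>v (1\<^sub>m d *\<^sub>v unit_vec d 0) = x" using first[OF x] by simp
    finally show ?thesis using C comm by blast
  qed
  with that[OF w] show ?thesis by blast
qed

subsection \<open>Positive semidefinite matrices\<close>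

lemma conjugate_one [simp]: "conjugate (1 :: 'a :: conjugatable_field) = 1"
proof -
  have "conjugate (1 :: 'a) * conjugate 1 = conjugate 1 * 1"
    using conjugate_dist_mul[of "1 :: 'a" 1] by simp
  moreover have "conjugate (1 :: 'a) \<noteq> 0" by simp
  ultimately show ?thesis using mult_left_cancel by blast
qed

lemma conjugate_inverse:
  fixes a :: "'a :: conjugatable_field"
  shows "conjugate (inverse a) = inverse (conjugate a)"
proof (cases "a = 0")
  case False
  hence "conjugate a * conjugate (inverse a) = 1"
    using conjugate_dist_mul[of a "inverse a"] by simp
  thus ?thesis by (metis inverse_unique)
qed simp

text \<open>Isolates the last variable in order to complete the square in it; hermitian symmetry
  turns the last column into the conjugate of the last row.\<close>

lemma quadratic_form_Suc:
  fixes X :: "nat \<Rightarrow> nat \<Rightarrow> 'a :: conjugatable_field"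
  assumes herm: "\<And>i j. i < Suc n \<Longrightarrow> j < Suc n \<Longrightarrow> X j i = conjugate (X i j)"
  shows "(\<Sum>i<Suc n. \<Sum>j<Suc n. X i j * v j * conjugate (v i)) =
    (\<Sum>i<n. \<Sum>j<n. X i j * v j * conjugate (v i)) + conjugate (\<Sum>j<n. X n j * v j) * v n
      + (\<Sum>j<n. X n j * v j) * conjugate (v n) + X n n * v n * conjugate (v n)"
proof -
  have "conjugate (\<Sum>j<n. X n j * v j) * v n = (\<Sum>i<n. X i n * v n * conjugate (v i))"
    using herm[of n, symmetric]
    by (auto simp: sum_conjugate sum_distrib_left conjugate_dist_mul ac_simps intro!: sum.cong)
  thus ?thesis by (simp add: sum.distrib sum_distrib_right add_ac)
qed

lemma quadratic_form_indicator:
  fixes X :: "nat \<Rightarrow> nat \<Rightarrow> 'a :: conjugatable_field"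
  assumes "i < n" and v: "\<And>j. j < n \<Longrightarrow> v j = (if j = i then 1 else 0)"
  shows "(\<Sum>k<n. \<Sum>j<n. X k j * v j * conjugate (v k)) = X i i"
proof -
  have "(\<Sum>k<n. \<Sum>j<n. X k j * v j * conjugate (v k)) =
      (\<Sum>k<n. \<Sum>j<n. if j = i then (if k = i then X k i else 0) else 0)"
    by (intro sum.cong refl) (simp add: v)
  thus ?thesis using assms(1) by simp
qed

text \<open>Induction on \<open>n\<close>, splitting off the Schur complement of the last diagonal entry of \<open>X\<close>.\<close>
lemma sum_mult_psd_nonneg:
  fixes X M :: "nat \<Rightarrow> nat \<Rightarrow> 'a :: {conjugatable_ordered_field, ordered_comm_ring}"
  assumes "\<And>i j. i < n \<Longrightarrow> j < n \<Longrightarrow> X j i = conjugate (X i j)"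
    and "\<And>v. 0 \<le> (\<Sum>i<n. \<Sum>j<n. X i j * v j * conjugate (v i))"
    and "\<And>v. 0 \<le> (\<Sum>i<n. \<Sum>j<n. M i j * v j * conjugate (v i))"
  shows "0 \<le> (\<Sum>i<n. \<Sum>j<n. X i j * M i j)"
  using assms
proof (induction n arbitrary: X)
  case (Suc n)
  note herm = Suc.prems(1) and Xpos = Suc.prems(2) and Mpos = Suc.prems(3)
  define d where "d = X n n"
  have cX: "conjugate (X i n) = X n i" "conjugate (X n i) = X i n" if "i < Suc n" for i
    using herm[of i n] herm[of n i] that by simp_all
  have cd: "conjugate d = d" unfolding d_def by (rule cX) simp
  have split: "(\<Sum>i<Suc n. \<Sum>j<Suc n. X i j * v j * conjugate (v i)) =
    (\<Sum>i<n. \<Sum>j<n. X i j * v j * conjugate (v i)) + conjugate (\<Sum>j<n. X n j * v j) * v n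
      + (\<Sum>j<n. X n j * v j) * conjugate (v n) + d * v n * conjugate (v n)" for v
    unfolding d_def by (rule quadratic_form_Suc[OF herm])
  have d0: "0 \<le> d"
    using Xpos[of "\<lambda>i. if i = n then 1 else 0"] unfolding split by simp
  have Mpos': "0 \<le> (\<Sum>i<n. \<Sum>j<n. M i j * v j * conjugate (v i))" for v
    using Mpos[of "\<lambda>i. if i = n then 0 else v i"] by simp
  show ?case
  proof (cases "d = 0")
    case True
    have row0: "X n i = 0" if i: "i < n" for i
    proof (rule ccontr)
      assume b: "X n i \<noteq> 0"
      define e where "e = X i i"
      have ce: "conjugate e = e" using herm[of i i, symmetric] i by (simp add: e_def)
      \<comment> \<open>With this value each of the two cross terms equals \<open>- (e + 1)\<close>,
        so the form takes the value \<open>- e - 2\<close>, although \<open>e\<close> is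
        nonnegative.\<close>
      define t where "t = - (e + 1) / conjugate (X n i)"
      define v where "v = (\<lambda>j. if j = n then t else if j = i then 1 else 0)"
      have "(\<Sum>j<n. X n j * v j) = (\<Sum>j<n. if j = i then X n j else 0)"
        by (intro sum.cong) (auto simp: v_def)
      hence s: "(\<Sum>j<n. X n j * v j) = X n i" using i by simp
      have q: "(\<Sum>k<n. \<Sum>j<n. X k j * v j * conjugate (v k)) = e"
        unfolding e_def by (rule quadratic_form_indicator[OF i]) (simp add: v_def)
      have ct: "conjugate (X n i) * t = - (e + 1)" using b by (simp add: t_def)
      have "X n i * conjugate t = conjugate (conjugate (X n i) * t)"
        by (simp add: conjugate_dist_mul)
      also have "\<dots> = - (e + 1)"
        unfolding ct conjugate_neg conjugate_dist_add ce conjugate_one ..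
      finally have ct': "X n i * conjugate t = - (e + 1)" .
      have "v n = t" by (simp add: v_def)
      with Xpos[of v] have "0 \<le> e + - (e + 1) + - (e + 1)"
        unfolding split s q by (simp add: True ct ct')
      moreover have "0 \<le> e"
      proof -
        let ?\<delta> = "\<lambda>j. if j = i then 1 else 0 :: 'a"
        have "(\<Sum>k<Suc n. \<Sum>j<Suc n. X k j * ?\<delta> j * conjugate (?\<delta> k)) = X i i"
          by (rule quadratic_form_indicator) (use i in simp_all)
        with Xpos[of ?\<delta>] show ?thesis by (simp only: e_def)
      qed
      moreover have one: "0 \<le> (1 :: 'a)" using conjugate_square_positive[of "1 :: 'a"] by simp
      \<comment> \<open>The order may be partial, so the contradiction comes from adding nonnegative
        terms until \<open>- 1\<close> itself is nonnegative.\<close>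
      ultimately have "0 \<le> (e + - (e + 1) + - (e + 1)) + e + 1"
        by (rule add_nonneg_nonneg[OF add_nonneg_nonneg])
      hence "0 \<le> (- 1 :: 'a)" by (simp add: algebra_simps)
      with one have "(1 :: 'a) = 0" by (meson neg_0_le_iff_le order.antisym)
      thus False by simp
    qed
    have col0: "X i n = 0" if "i < n" for i
      using cX(2)[of i] row0[OF that] that by simp
    have "0 \<le> (\<Sum>i<n. \<Sum>j<n. X i j * M i j)"
    proof (rule Suc.IH[OF _ _ Mpos'])
      show "0 \<le> (\<Sum>i<n. \<Sum>j<n. X i j * v j * conjugate (v i))" for v
        using Xpos[of "\<lambda>i. if i = n then 0 else v i"] by simp
    qed (rule herm, simp_all)
    also have "\<dots> = (\<Sum>i<Suc n. \<Sum>j<Suc n. X i j * M i j)"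
      using True by (simp add: row0 col0 d_def)
    finally show ?thesis .
  next
    case False
    define Y where "Y = (\<lambda>i j. X i j - X i n * X n j / d)"
    have Y0: "Y i n = 0" "Y n i = 0" for i
      using False by (simp_all add: Y_def d_def)
    have "0 \<le> (\<Sum>i<n. \<Sum>j<n. Y i j * M i j)"
    proof (rule Suc.IH[OF _ _ Mpos'])
      fix i j assume ij: "i < n" "j < n"
      have "conjugate (X i n * X n j / d) = X j n * X n i / d"
        using ij by (simp add: divide_inverse conjugate_dist_mul conjugate_inverse cd cX)
      hence "conjugate (Y i j) = conjugate (X i j) + - (X j n * X n i / d)"
        unfolding Y_def diff_conv_add_uminus conjugate_dist_add conjugate_neg by (rule arg_cong)
      also have "conjugate (X i j) = X j i" using herm[of i j] ij by simp
      finally show "Y j i = conjugate (Y i j)" by (simp add: Y_def)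
    next
      fix v :: "nat \<Rightarrow> 'a"
      define s where "s = (\<Sum>j<n. X n j * v j)"
      \<comment> \<open>The last coordinate \<open>- s / d\<close> completes the square: the form of
        \<open>X\<close> at \<open>u\<close> is the form of the Schur complement \<open>Y\<close> at
        \<open>v\<close>.\<close>
      define u where "u = v(n := - s / d)"
      have cs: "conjugate s = (\<Sum>i<n. X i n * conjugate (v i))"
        by (auto simp: s_def sum_conjugate conjugate_dist_mul cX intro!: sum.cong)
      have "(\<Sum>i<n. \<Sum>j<n. Y i j * v j * conjugate (v i)) =
          (\<Sum>i<n. \<Sum>j<n. X i j * v j * conjugate (v i)) -
          (\<Sum>i<n. \<Sum>j<n. X i n * conjugate (v i) * (X n j * v j)) / d"
      proof -
        have "Y i j * v j * conjugate (v i) = X i j * v j * conjugate (v i)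
            - X i n * conjugate (v i) * (X n j * v j) / d" for i j
          by (simp add: Y_def divide_inverse left_diff_distrib right_diff_distrib ac_simps)
        thus ?thesis by (simp only: sum_subtractf sum_divide_distrib)
      qed
      also have "(\<Sum>i<n. \<Sum>j<n. X i n * conjugate (v i) * (X n j * v j)) = conjugate s * s"
        unfolding cs unfolding s_def by (simp add: sum_product)
      finally have Y: "(\<Sum>i<n. \<Sum>j<n. Y i j * v j * conjugate (v i)) =
          (\<Sum>i<n. \<Sum>j<n. X i j * v j * conjugate (v i)) - conjugate s * s / d" .
      have un: "u n = - s / d" "conjugate (u n) = - conjugate s / d"
        by (simp_all add: u_def divide_inverse conjugate_dist_mul conjugate_inverse conjugate_neg cd)
      have su: "(\<Sum>j<n. X n j * u j) = s"
        "(\<Sum>i<n. \<Sum>j<n. X i j * u j * conjugate (u i)) = (\<Sum>i<n. \<Sum>j<n. X i j * v j * conjugate (v i))"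
        by (simp_all add: u_def s_def)
      have "0 \<le> (\<Sum>i<n. \<Sum>j<n. X i j * v j * conjugate (v i))
          + conjugate s * (- s / d) + s * (- conjugate s / d) + d * (- s / d) * (- conjugate s / d)"
        using Xpos[of u] unfolding split su un(2) unfolding un(1) .
      also have "\<dots> = (\<Sum>i<n. \<Sum>j<n. Y i j * v j * conjugate (v i))"
      proof -
        have "d * (- s / d) = - s" using False by simp
        thus ?thesis unfolding Y by (simp add: mult.commute)
      qed
      finally show "0 \<le> (\<Sum>i<n. \<Sum>j<n. Y i j * v j * conjugate (v i))" .
    qed
    also have "(\<Sum>i<n. \<Sum>j<n. Y i j * M i j) = (\<Sum>i<Suc n. \<Sum>j<Suc n. Y i j * M i j)"
      by (simp add: Y0)
    finally have 1: "0 \<le> (\<Sum>i<Suc n. \<Sum>j<Suc n. Y i j * M i j)" .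
    \<comment> \<open>Writing \<open>inverse d\<close> as \<open>d\<close> times a conjugate square
      reduces its nonnegativity to that of \<open>d\<close>.\<close>
    have "d * (inverse d * conjugate (inverse d)) = inverse d"
      using False by (simp add: conjugate_inverse cd)
    hence "0 \<le> inverse d"
      using mult_nonneg_nonneg[OF d0 conjugate_square_positive[of "inverse d"]] by (simp only:)
    \<comment> \<open>The rank-one part removed from \<open>X\<close> pairs with \<open>M\<close> to
      \<open>inverse d\<close> times the form of \<open>M\<close> at the last row of
      \<open>X\<close>.\<close>
    moreover have "0 \<le> (\<Sum>i<Suc n. \<Sum>j<Suc n. M i j * X n j * conjugate (X n i))"
      by (rule Mpos)
    ultimately have "0 \<le> inverse d * (\<Sum>i<Suc n. \<Sum>j<Suc n. M i j * X n j * conjugate (X n i))"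
      by (rule mult_nonneg_nonneg)
    also have "\<dots> = (\<Sum>i<Suc n. \<Sum>j<Suc n. X i n * X n j / d * M i j)"
      unfolding sum_distrib_left
      by (intro sum.cong refl) (simp add: cX divide_inverse ac_simps)
    finally have "0 \<le> (\<Sum>i<Suc n. \<Sum>j<Suc n. Y i j * M i j)
        + (\<Sum>i<Suc n. \<Sum>j<Suc n. X i n * X n j / d * M i j)"
      by (rule add_nonneg_nonneg[OF 1])
    also have "\<dots> = (\<Sum>i<Suc n. \<Sum>j<Suc n. X i j * M i j)"
      unfolding sum.distrib[symmetric] by (simp add: Y_def left_diff_distrib del: sum.lessThan_Suc)
    finally show ?thesis .
  qed
qed simp

subsection \<open>Block matrices\<close>

lemma block_mat_carrier [simp]: "block_mat k n W \<in> carrier_mat (k * n) (k * n)"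
  by (simp add: block_mat_def)

lemma block_mat_index:
  assumes "i < k" "j < k" "a < n" "b < n"
  shows "block_mat k n W $$ (i * n + a, j * n + b) = W i j $$ (a, b)"
  using assms mult_add_less_mult[of i k a n] mult_add_less_mult[of j k b n]
  by (simp add: block_mat_def)

lemma block_mat_cong:
  assumes "\<And>i j. i < k \<Longrightarrow> j < k \<Longrightarrow> W i j = W' i j"
  shows "block_mat k n W = block_mat k n W'"
  by (intro eq_matI) (auto simp: block_mat_def less_mult_imp_div_less assms)

lemma mat_block_carrier [simp]: "mat_block n V i j \<in> carrier_mat n n"
  by (simp add: mat_block_def)

lemma block_mat_mat_block:
  assumes V: "V \<in> carrier_mat (k * n) (k * n)"
  shows "block_mat k n (mat_block n V) = V"
proof (rule eq_matI)
  fix r s assume rs: "r < dim_row V" "s < dim_col V"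
  with V have "r < k * n" "s < k * n" by auto
  moreover from this have "n \<noteq> 0" by (cases n) auto
  ultimately show "block_mat k n (mat_block n V) $$ (r, s) = V $$ (r, s)"
    by (simp add: block_mat_def mat_block_def)
qed (use V in \<open>simp_all add: block_mat_def\<close>)

lemma mat_block_block_mat:
  assumes "i < k" "j < k" "W i j \<in> carrier_mat n n"
  shows "mat_block n (block_mat k n W) i j = W i j"
proof (rule eq_matI)
  fix a b assume "a < dim_row (W i j)" "b < dim_col (W i j)"
  with assms(3) have ab: "a < n" "b < n" by auto
  thus "mat_block n (block_mat k n W) i j $$ (a, b) = W i j $$ (a, b)"
    using block_mat_index[OF assms(1,2) ab, of W] by (simp add: mat_block_def)
qed (use assms(3) in \<open>simp_all add: mat_block_def\<close>)

lemma quadratic_form_block_mat: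
  fixes W :: "nat \<Rightarrow> nat \<Rightarrow> 'a :: conjugatable_field mat"
  assumes W: "\<And>i j. i < k \<Longrightarrow> j < k \<Longrightarrow> W i j \<in> carrier_mat n n"
    and x: "x \<in> carrier_vec (k * n)"
  shows "(block_mat k n W *\<^sub>v x) \<bullet>c x =
    (\<Sum>i<k. \<Sum>j<k. (W i j *\<^sub>v vec n (\<lambda>a. x $ (j * n + a))) \<bullet>c vec n (\<lambda>a. x $ (i * n + a)))"
proof -
  have "(block_mat k n W *\<^sub>v x) \<bullet>c x =
      (\<Sum>i<k. \<Sum>a<n. \<Sum>j<k. \<Sum>b<n. block_mat k n W $$ (i * n + a, j * n + b) * x $ (j * n + b)
        * conjugate (x $ (i * n + a)))"
    unfolding quadratic_form_sum[OF block_mat_carrier x x] sum_lessThan_mult ..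
  also have "\<dots> = (\<Sum>i<k. \<Sum>j<k. \<Sum>a<n. \<Sum>b<n. W i j $$ (a, b) * x $ (j * n + b)
        * conjugate (x $ (i * n + a)))"
    by (subst sum.swap[of _ "{..<n}"]) (simp add: block_mat_index)
  also have "\<dots> = (\<Sum>i<k. \<Sum>j<k. (W i j *\<^sub>v vec n (\<lambda>a. x $ (j * n + a))) \<bullet>c vec n (\<lambda>a. x $ (i * n + a)))"
    by (intro sum.cong refl) (simp add: quadratic_form_sum[OF W])
  finally show ?thesis .
qed

text \<open>Confines the index arithmetic: from here on, positivity of a block matrix is a statement
  about tuples of vectors.\<close>

lemma psd_block_mat_iff:
  fixes W :: "nat \<Rightarrow> nat \<Rightarrow> 'a :: conjugatable_ordered_field mat"
  assumes W: "\<And>i j. i < k \<Longrightarrow> j < k \<Longrightarrow> W i j \<in> carrier_mat n n"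
  shows "psd_mat (k * n) (block_mat k n W) \<longleftrightarrow>
    (\<forall>i<k. \<forall>j<k. W j i = mat_adjoint (W i j)) \<and>
    (\<forall>x. (\<forall>i<k. x i \<in> carrier_vec n) \<longrightarrow> 0 \<le> (\<Sum>i<k. \<Sum>j<k. (W i j *\<^sub>v x j) \<bullet>c x i))"
proof -
  have "hermitian_mat (block_mat k n W) \<longleftrightarrow> (\<forall>i<k. \<forall>j<k. W j i = mat_adjoint (W i j))"
  proof
    assume h: "hermitian_mat (block_mat k n W)"
    show "\<forall>i<k. \<forall>j<k. W j i = mat_adjoint (W i j)"
    proof (intro allI impI eq_matI)
      fix i j a b assume ij: "i < k" "j < k"
        and "a < dim_row (mat_adjoint (W i j))" "b < dim_col (mat_adjoint (W i j))"
      hence ab: "a < n" "b < n" using W[OF ij] by auto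
      have "W j i $$ (a, b) = mat_adjoint (block_mat k n W) $$ (j * n + a, i * n + b)"
        using h block_mat_index[OF ij(2,1) ab, of W] by (simp add: hermitian_mat_def)
      also have "\<dots> = conjugate (block_mat k n W $$ (i * n + b, j * n + a))"
        using mult_add_less_mult[OF ij(1) ab(2)] mult_add_less_mult[OF ij(2) ab(1)]
        by (intro mat_adjoint_index) (auto simp: block_mat_def)
      also have "\<dots> = mat_adjoint (W i j) $$ (a, b)"
        using ab W[OF ij] by (simp add: block_mat_index[OF ij ab(2,1)])
      finally show "W j i $$ (a, b) = mat_adjoint (W i j) $$ (a, b)" .
    qed (simp_all add: carrier_matD(1)[OF W] carrier_matD(2)[OF W])
  next
    assume h: "\<forall>i<k. \<forall>j<k. W j i = mat_adjoint (W i j)"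
    show "hermitian_mat (block_mat k n W)"
      unfolding hermitian_mat_def
    proof (rule eq_matI)
      fix r s assume "r < dim_row (block_mat k n W)" "s < dim_col (block_mat k n W)"
      hence rs: "r < k * n" "s < k * n" by (auto simp: block_mat_def)
      hence "n > 0" by (cases n) auto
      hence m: "r mod n < n" "s mod n < n" by auto
      have d: "r div n < k" "s div n < k" using rs by (auto simp: less_mult_imp_div_less)
      have "mat_adjoint (block_mat k n W) $$ (r, s) = conjugate (W (s div n) (r div n) $$ (s mod n, r mod n))"
        using rs by (simp add: block_mat_def)
      also have "\<dots> = mat_adjoint (W (s div n) (r div n)) $$ (r mod n, s mod n)"
        using W[OF d(2,1)] m by simp
      also have "mat_adjoint (W (s div n) (r div n)) = W (r div n) (s div n)"
        by (rule h[rule_format, OF d(2,1), symmetric])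
      finally show "mat_adjoint (block_mat k n W) $$ (r, s) = block_mat k n W $$ (r, s)"
        using rs by (simp add: block_mat_def)
    qed (auto simp: block_mat_def)
  qed
  moreover have "(\<forall>v \<in> carrier_vec (k * n). 0 \<le> (block_mat k n W *\<^sub>v v) \<bullet>c v) \<longleftrightarrow>
    (\<forall>x. (\<forall>i<k. x i \<in> carrier_vec n) \<longrightarrow> 0 \<le> (\<Sum>i<k. \<Sum>j<k. (W i j *\<^sub>v x j) \<bullet>c x i))"
  proof (intro iffI allI impI ballI)
    fix x :: "nat \<Rightarrow> 'a vec"
    assume pos: "\<forall>v \<in> carrier_vec (k * n). 0 \<le> (block_mat k n W *\<^sub>v v) \<bullet>c v"
      and x: "\<forall>i<k. x i \<in> carrier_vec n"
    define v where "v = vec (k * n) (\<lambda>r. x (r div n) $ (r mod n))"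
    have v: "v \<in> carrier_vec (k * n)" by (simp add: v_def)
    have eq: "vec n (\<lambda>a. v $ (i * n + a)) = x i" if i: "i < k" for i
    proof (rule eq_vecI)
      fix a assume "a < dim_vec (x i)"
      with x i have "a < n" by auto
      with mult_add_less_mult[OF i this] show "vec n (\<lambda>a. v $ (i * n + a)) $ a = x i $ a"
        by (simp add: v_def)
    qed (use x i in auto)
    have "(block_mat k n W *\<^sub>v v) \<bullet>c v = (\<Sum>i<k. \<Sum>j<k. (W i j *\<^sub>v x j) \<bullet>c x i)"
      by (subst quadratic_form_block_mat) (use W v eq in simp_all)
    with pos v show "0 \<le> (\<Sum>i<k. \<Sum>j<k. (W i j *\<^sub>v x j) \<bullet>c x i)" by metis
  next
    fix v :: "'a vec"
    assume pos: "\<forall>x. (\<forall>i<k. x i \<in> carrier_vec n) \<longrightarrow> 0 \<le> (\<Sum>i<k. \<Sum>j<k. (W i j *\<^sub>v x j) \<bullet>c x i)"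
      and v: "v \<in> carrier_vec (k * n)"
    show "0 \<le> (block_mat k n W *\<^sub>v v) \<bullet>c v"
      using pos[rule_format, of "\<lambda>i. vec n (\<lambda>a. v $ (i * n + a))"]
      by (subst quadratic_form_block_mat) (use W v in simp_all)
  qed
  ultimately show ?thesis by (simp add: psd_mat_def)
qed

subsection \<open>Linear maps on matrices\<close>

text \<open>Entrywise, so that the empty sum is still a matrix of size \<open>n\<close>.\<close>

definition matsum :: "nat \<Rightarrow> 'b set \<Rightarrow> ('b \<Rightarrow> 'a :: comm_monoid_add mat) \<Rightarrow> 'a mat" where
  "matsum n I F = mat n n (\<lambda>(a, b). \<Sum>p\<in>I. F p $$ (a, b))"

lemma matsum_carrier [simp]: "matsum n I F \<in> carrier_mat n n"
  by (simp add: matsum_def)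

lemma matsum_index [simp]:
  "a < n \<Longrightarrow> b < n \<Longrightarrow> matsum n I F $$ (a, b) = (\<Sum>p\<in>I. F p $$ (a, b))"
  by (simp add: matsum_def)

lemma quadratic_form_matsum:
  fixes F :: "'b \<Rightarrow> 'a :: conjugatable_field mat"
  assumes F: "\<And>p. p \<in> I \<Longrightarrow> F p \<in> carrier_mat n n"
    and u: "u \<in> carrier_vec n" and v: "v \<in> carrier_vec n"
  shows "(matsum n I F *\<^sub>v u) \<bullet>c v = (\<Sum>p\<in>I. (F p *\<^sub>v u) \<bullet>c v)"
proof -
  have "(matsum n I F *\<^sub>v u) \<bullet>c v =
      (\<Sum>i<n. \<Sum>j<n. \<Sum>p\<in>I. F p $$ (i, j) * u $ j * conjugate (v $ i))"
    unfolding quadratic_form_sum[OF matsum_carrier u v] by (simp add: sum_distrib_right)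
  also have "\<dots> = (\<Sum>p\<in>I. \<Sum>i<n. \<Sum>j<n. F p $$ (i, j) * u $ j * conjugate (v $ i))"
    by (simp only: sum.swap[of _ I])
  also have "\<dots> = (\<Sum>p\<in>I. (F p *\<^sub>v u) \<bullet>c v)"
    by (intro sum.cong refl) (simp only: quadratic_form_sum[OF F u v])
  finally show ?thesis .
qed

lemma matrix_unit_carrier [simp]: "matrix_unit n i j \<in> carrier_mat n n"
  by (simp add: matrix_unit_def)

locale linear_mat_map =
  fixes n :: nat and L :: "'a :: conjugatable_ordered_field mat \<Rightarrow> 'a mat"
  assumes closed: "X \<in> carrier_mat n n \<Longrightarrow> L X \<in> carrier_mat n n"
    and add: "X \<in> carrier_mat n n \<Longrightarrow> Y \<in> carrier_mat n n \<Longrightarrow> L (X + Y) = L X + L Y"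
    and smult: "X \<in> carrier_mat n n \<Longrightarrow> L (c \<cdot>\<^sub>m X) = c \<cdot>\<^sub>m L X"
begin

lemma matsum:
  assumes "finite I" "\<And>p. p \<in> I \<Longrightarrow> F p \<in> carrier_mat n n"
  shows "L (matsum n I F) = matsum n I (\<lambda>p. L (F p))"
  using assms
proof (induction I rule: finite_induct)
  case empty
  \<comment> \<open>The empty sum is the zero matrix, which equals 0 times itself, so homogeneity
    applies.\<close>
  have "matsum n {} F = 0 \<cdot>\<^sub>m matsum n {} F" by (intro eq_matI) (auto simp: matsum_def)
  hence "L (matsum n {} F) = L (0 \<cdot>\<^sub>m matsum n {} F)" by (rule arg_cong)
  also have "\<dots> = matsum n {} (\<lambda>p. L (F p))"
    using closed[of "matsum n {} F"] by (intro eq_matI) (auto simp: smult matsum_def)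
  finally show ?case .
next
  case (insert p I)
  have F: "F p \<in> carrier_mat n n" using insert.prems by simp
  have "matsum n (insert p I) F = F p + matsum n I F"
    using insert.hyps F by (intro eq_matI) (auto simp: matsum_def)
  hence "L (matsum n (insert p I) F) = L (F p) + matsum n I (\<lambda>p. L (F p))"
    using insert F by (simp add: add)
  also have "\<dots> = matsum n (insert p I) (\<lambda>p. L (F p))"
    using insert.hyps closed[OF F] by (intro eq_matI) (auto simp: matsum_def)
  finally show ?case .
qed

lemma expand:
  assumes X: "X \<in> carrier_mat n n"
  shows "L X = matsum n ({..<n} \<times> {..<n}) (\<lambda>(i, j). X $$ (i, j) \<cdot>\<^sub>m L (matrix_unit n i j))"
proof -
  have "X = matsum n ({..<n} \<times> {..<n}) (\<lambda>(i, j). X $$ (i, j) \<cdot>\<^sub>m matrix_unit n i j)" (is "_ = ?S")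
  proof (rule eq_matI)
    fix a b assume "a < dim_row ?S" "b < dim_col ?S"
    hence ab: "a < n" "b < n" by (auto simp: matsum_def)
    have "?S $$ (a, b) = (\<Sum>p\<in>{..<n} \<times> {..<n}. if p = (a, b) then X $$ (a, b) else 0)"
      unfolding matsum_index[OF ab]
      using ab by (intro sum.cong refl) (auto simp: matrix_unit_def split: if_splits)
    thus "X $$ (a, b) = ?S $$ (a, b)" using ab by simp
  qed (use X in \<open>auto simp: matsum_def\<close>)
  hence "L X = L ?S" by (rule arg_cong)
  also have "\<dots> = matsum n ({..<n} \<times> {..<n}) (\<lambda>p. L (case p of (i, j) \<Rightarrow> X $$ (i, j) \<cdot>\<^sub>m matrix_unit n i j))"
    by (rule matsum) auto
  also have "(\<lambda>p. L (case p of (i, j) \<Rightarrow> X $$ (i, j) \<cdot>\<^sub>m matrix_unit n i j)) =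
      (\<lambda>(i, j). X $$ (i, j) \<cdot>\<^sub>m L (matrix_unit n i j))"
    by (auto simp: fun_eq_iff smult)
  finally show ?thesis .
qed

text \<open>In the basis of matrix units, with entry \<open>(a, b)\<close> at position
  \<open>a * n + b\<close>, the map is a square matrix with trivial kernel.\<close>

lemma surjective_if_injective:
  assumes inj: "\<And>X. X \<in> carrier_mat n n \<Longrightarrow> L X = 0\<^sub>m n n \<Longrightarrow> X = 0\<^sub>m n n"
    and Y: "Y \<in> carrier_mat n n"
  shows "\<exists>X \<in> carrier_mat n n. L X = Y"
proof -
  define M where "M = mat (n * n) (n * n)
    (\<lambda>(r, s). L (matrix_unit n (s div n) (s mod n)) $$ (r div n, r mod n))"
  have M: "M \<in> carrier_mat (n * n) (n * n)" by (simp add: M_def)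
  define unvec where "unvec = (\<lambda>c :: 'a vec. mat n n (\<lambda>(i, j). c $ (i * n + j)))"
  have unvec: "unvec c \<in> carrier_mat n n" for c by (simp add: unvec_def)
  have idx: "a * n + b < n * n" if "a < n" "b < n" for a b
    using mult_add_less_mult that by blast
  have L_unvec: "L (unvec c) $$ (a, b) = (M *\<^sub>v c) $ (a * n + b)"
    if c: "c \<in> carrier_vec (n * n)" and ab: "a < n" "b < n" for c a b
  proof -
    have "(M *\<^sub>v c) $ (a * n + b) = (\<Sum>s<n * n. M $$ (a * n + b, s) * c $ s)"
      using c idx[OF ab] M by (auto simp: scalar_prod_def lessThan_atLeast0 intro!: sum.cong)
    also have "\<dots> = (\<Sum>i<n. \<Sum>j<n. unvec c $$ (i, j) * L (matrix_unit n i j) $$ (a, b))"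
      unfolding sum_lessThan_mult using ab idx
      by (intro sum.cong refl) (simp add: M_def unvec_def mult.commute)
    also have "\<dots> = (\<Sum>(i, j)\<in>{..<n} \<times> {..<n}. unvec c $$ (i, j) * L (matrix_unit n i j) $$ (a, b))"
      by (rule sum.cartesian_product)
    also have "\<dots> = L (unvec c) $$ (a, b)"
      unfolding expand[OF unvec] matsum_index[OF ab]
    proof (intro sum.cong refl, clarify)
      fix i j
      show "unvec c $$ (i, j) * L (matrix_unit n i j) $$ (a, b) =
          (unvec c $$ (i, j) \<cdot>\<^sub>m L (matrix_unit n i j)) $$ (a, b)"
        using closed[of "matrix_unit n i j"] ab by simp
    qed
    finally show ?thesis by simp
  qed
  have "c = 0\<^sub>v (n * n)" if c: "c \<in> carrier_vec (n * n)" "M *\<^sub>v c = 0\<^sub>v (n * n)" for c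
  proof -
    have "L (unvec c) = 0\<^sub>m n n"
    proof (rule eq_matI)
      fix a b assume "a < dim_row (0\<^sub>m n n :: 'a mat)" "b < dim_col (0\<^sub>m n n :: 'a mat)"
      hence ab: "a < n" "b < n" by auto
      show "L (unvec c) $$ (a, b) = 0\<^sub>m n n $$ (a, b)"
        unfolding L_unvec[OF c(1) ab] c(2) using ab idx[OF ab] by simp
    qed (use closed[OF unvec] in auto)
    hence 0: "unvec c = 0\<^sub>m n n" by (rule inj[OF unvec])
    show ?thesis
    proof (rule eq_vecI)
      fix r assume "r < dim_vec (0\<^sub>v (n * n) :: 'a vec)"
      hence r: "r < n * n" by simp
      hence "0 < n" by (cases n) auto
      hence m: "r div n < n" "r mod n < n" using r by (auto simp: less_mult_imp_div_less)
      have "c $ r = unvec c $$ (r div n, r mod n)" using m by (simp add: unvec_def)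
      thus "c $ r = 0\<^sub>v (n * n) $ r" unfolding 0 using m r by simp
    qed (use c in simp)
  qed
  then obtain N where N: "N \<in> carrier_mat (n * n) (n * n)" "M * N = 1\<^sub>m (n * n)"
    using trivial_kernel_imp_invertible[OF M] by blast
  define y where "y = vec (n * n) (\<lambda>r. Y $$ (r div n, r mod n))"
  have y: "y \<in> carrier_vec (n * n)" by (simp add: y_def)
  have Ny: "N *\<^sub>v y \<in> carrier_vec (n * n)" using N y by simp
  have MNy: "M *\<^sub>v (N *\<^sub>v y) = y"
    using assoc_mult_mat_vec[OF M N(1) y] N(2) y by simp
  have "L (unvec (N *\<^sub>v y)) = Y"
  proof (rule eq_matI)
    fix a b assume "a < dim_row Y" "b < dim_col Y"
    with Y have ab: "a < n" "b < n" by auto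
    show "L (unvec (N *\<^sub>v y)) $$ (a, b) = Y $$ (a, b)"
      unfolding L_unvec[OF Ny ab] MNy using ab idx[OF ab] by (simp add: y_def)
  qed (use closed[OF unvec] Y in auto)
  thus ?thesis using unvec by blast
qed

text \<open>Brings \<open>v\<^sup>* L(X) v\<close> into the shape of
  \<open>sum_mult_psd_nonneg\<close>: \<open>X\<close> paired with the scalars
  \<open>v\<^sup>* L(E\<^sub>i\<^sub>j) v\<close>.\<close>

lemma quadratic_form_expand:
  assumes X: "X \<in> carrier_mat n n" and v: "v \<in> carrier_vec n"
  shows "(L X *\<^sub>v v) \<bullet>c v = (\<Sum>i<n. \<Sum>j<n. X $$ (i, j) * ((L (matrix_unit n i j) *\<^sub>v v) \<bullet>c v))"
proof -
  have "(L X *\<^sub>v v) \<bullet>c v =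
      (\<Sum>(i, j)\<in>{..<n} \<times> {..<n}. ((X $$ (i, j) \<cdot>\<^sub>m L (matrix_unit n i j)) *\<^sub>v v) \<bullet>c v)"
    unfolding expand[OF X] using closed
    by (subst quadratic_form_matsum[OF _ v v]) (auto intro!: sum.cong)
  also have "\<dots> = (\<Sum>(i, j)\<in>{..<n} \<times> {..<n}. X $$ (i, j) * ((L (matrix_unit n i j) *\<^sub>v v) \<bullet>c v))"
  proof (intro sum.cong refl, clarify)
    fix i j
    have E: "L (matrix_unit n i j) \<in> carrier_mat n n" by (simp add: closed)
    have "(X $$ (i, j) \<cdot>\<^sub>m L (matrix_unit n i j)) *\<^sub>v v = X $$ (i, j) \<cdot>\<^sub>v (L (matrix_unit n i j) *\<^sub>v v)"
      using E v by (intro eq_vecI) auto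
    thus "((X $$ (i, j) \<cdot>\<^sub>m L (matrix_unit n i j)) *\<^sub>v v) \<bullet>c v =
        X $$ (i, j) * ((L (matrix_unit n i j) *\<^sub>v v) \<bullet>c v)"
      using mult_mat_vec_carrier[OF E v] v by (simp add: smult_scalar_prod_distrib[of _ n])
  qed
  also have "\<dots> = (\<Sum>i<n. \<Sum>j<n. X $$ (i, j) * ((L (matrix_unit n i j) *\<^sub>v v) \<bullet>c v))"
    by (rule sum.cartesian_product[symmetric])
  finally show ?thesis .
qed

end

section \<open>Complete positivity, the Choi matrix and positivity\<close>

text \<open>The Choi matrix is the image, at level \<open>k = n\<close>, of the block matrix of all
  matrix units. The form of the latter at a tuple \<open>x\<close> is the squared modulus of the sum
  of the entries \<open>x i $ i\<close>.\<close>

lemma completely_positive_imp_psd_choi: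
  fixes L :: "'a :: conjugatable_ordered_field mat \<Rightarrow> 'a mat"
  assumes cp: "completely_positive_map n m L"
  shows "psd_mat (n * m) (choi_mat n m L)"
proof (cases "n = 0")
  \<comment> \<open>Complete positivity only speaks of \<open>k \<ge> 1\<close>; here the Choi
    matrix is empty.\<close>
  case True
  have "psd_mat (0 * m) (block_mat 0 m (\<lambda>i j. L (matrix_unit n i j)))"
    by (subst psd_block_mat_iff) auto
  thus ?thesis using True by (simp add: choi_mat_def)
next
  case False
  let ?E = "block_mat n n (matrix_unit n) :: 'a mat"
  have "psd_mat (n * n) ?E"
  proof (subst psd_block_mat_iff)
    show "(\<forall>i<n. \<forall>j<n. matrix_unit n j i = mat_adjoint (matrix_unit n i j :: 'a mat)) \<and>
      (\<forall>x. (\<forall>i<n. x i \<in> carrier_vec n) \<longrightarrow>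
        0 \<le> (\<Sum>i<n. \<Sum>j<n. (matrix_unit n i j *\<^sub>v x j) \<bullet>c x i :: 'a))"
    proof (intro conjI allI impI)
      fix i j
      show "matrix_unit n j i = mat_adjoint (matrix_unit n i j :: 'a mat)"
        by (intro eq_matI) (auto simp: matrix_unit_def)
    next
      fix x :: "nat \<Rightarrow> 'a vec" assume x: "\<forall>i<n. x i \<in> carrier_vec n"
      have "(matrix_unit n i j *\<^sub>v x j) \<bullet>c x i = conjugate (x i $ i) * x j $ j"
        if "i < n" "j < n" for i j
      proof -
        have "(matrix_unit n i j *\<^sub>v x j) \<bullet>c x i =
            (\<Sum>a<n. \<Sum>b<n. matrix_unit n i j $$ (a, b) * x j $ b * conjugate (x i $ a))"
          using that x by (intro quadratic_form_sum) auto
        also have "\<dots> =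
            (\<Sum>a<n. \<Sum>b<n. if b = j then (if a = i then x j $ b * conjugate (x i $ a) else 0) else 0)"
          by (intro sum.cong refl) (simp add: matrix_unit_def)
        finally
        show ?thesis using that by (simp add: mult.commute)
      qed
      hence "(\<Sum>i<n. \<Sum>j<n. (matrix_unit n i j *\<^sub>v x j) \<bullet>c x i) =
          (\<Sum>i<n. \<Sum>j<n. conjugate (x i $ i) * x j $ j)"
        by (intro sum.cong refl) (simp only: lessThan_iff)
      also have "\<dots> = conjugate (\<Sum>i<n. x i $ i) * (\<Sum>j<n. x j $ j)"
        by (simp only: sum_product[symmetric] sum_conjugate finite_lessThan)
      also have "\<dots> = (\<Sum>j<n. x j $ j) * conjugate (\<Sum>i<n. x i $ i)" by (rule mult.commute)
      finally
      show "0 \<le> (\<Sum>i<n. \<Sum>j<n. (matrix_unit n i j *\<^sub>v x j) \<bullet>c x i)"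
        by (simp only: conjugate_square_positive)
    qed
  qed simp
  hence "psd_mat (n * m) (block_mat n m (\<lambda>i j. L (mat_block n ?E i j)))"
    using cp False by (auto simp: completely_positive_map_def positive_map_def)
  also have "block_mat n m (\<lambda>i j. L (mat_block n ?E i j)) = choi_mat n m L"
    unfolding choi_mat_def by (intro block_mat_cong) (simp add: mat_block_block_mat)
  finally show ?thesis .
qed

text \<open>Over the reals a nonnegative form does not force symmetry, so hermitian values are
  obtained from compatibility with adjoints.\<close>

locale linear_star_map = linear_mat_map n L
  for n and L :: "'a :: {conjugatable_ordered_field, ordered_comm_ring} mat \<Rightarrow> 'a mat" +
  assumes adjoint: "X \<in> carrier_mat n n \<Longrightarrow> L (mat_adjoint X) = mat_adjoint (L X)"
begin

text \<open>For fixed \<open>v\<close> let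
  \<open>M\<^sub>i\<^sub>j = v\<^sup>* L(E\<^sub>i\<^sub>j) v\<close>. The form of \<open>M\<close>
  at \<open>u\<close> is that of the Choi matrix at the tuple of multiples
  \<open>u i \<cdot>\<^sub>v v\<close>, hence nonnegative.\<close>

lemma positive_if_psd_choi:
  assumes "psd_mat (n * n) (choi_mat n n L)"
  shows "positive_map n n L"
  unfolding positive_map_def
proof (intro allI impI)
  fix X :: "'a mat" assume psd: "psd_mat n X"
  hence X: "X \<in> carrier_mat n n" and herm: "mat_adjoint X = X"
    and pos: "\<And>v. v \<in> carrier_vec n \<Longrightarrow> 0 \<le> (X *\<^sub>v v) \<bullet>c v"
    by (auto simp: psd_mat_def hermitian_mat_def)
  have E: "L (matrix_unit n i j) \<in> carrier_mat n n" for i j by (simp add: closed)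
  have choi: "0 \<le> (\<Sum>i<n. \<Sum>j<n. (L (matrix_unit n i j) *\<^sub>v x j) \<bullet>c x i)"
    if "\<And>i. x i \<in> carrier_vec n" for x
    using psd_block_mat_iff[of n "\<lambda>i j. L (matrix_unit n i j)" n, OF E, THEN iffD1,
      OF assms[unfolded choi_mat_def], THEN conjunct2] that by blast
  have "0 \<le> (L X *\<^sub>v v) \<bullet>c v" if v: "v \<in> carrier_vec n" for v
    unfolding quadratic_form_expand[OF X v]
  proof (rule sum_mult_psd_nonneg)
    fix i j assume "i < n" "j < n"
    thus "X $$ (j, i) = conjugate (X $$ (i, j))"
      using mat_adjoint_index[of j X i] X by (simp add: herm)
  next
    fix u :: "nat \<Rightarrow> 'a"
    have "(X *\<^sub>v vec n u) \<bullet>c vec n u = (\<Sum>i<n. \<Sum>j<n. X $$ (i, j) * u j * conjugate (u i))"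
      using quadratic_form_sum[OF X, of "vec n u" "vec n u"] by simp
    thus "0 \<le> (\<Sum>i<n. \<Sum>j<n. X $$ (i, j) * u j * conjugate (u i))"
      using pos[of "vec n u"] by simp
  next
    fix u :: "nat \<Rightarrow> 'a"
    have "(L (matrix_unit n i j) *\<^sub>v (u j \<cdot>\<^sub>v v)) \<bullet>c (u i \<cdot>\<^sub>v v) =
        ((L (matrix_unit n i j) *\<^sub>v v) \<bullet>c v) * u j * conjugate (u i)" for i j
    proof -
      have "(L (matrix_unit n i j) *\<^sub>v (u j \<cdot>\<^sub>v v)) = u j \<cdot>\<^sub>v (L (matrix_unit n i j) *\<^sub>v v)"
        by (rule mult_mat_vec[OF E v])
      moreover have Ev: "L (matrix_unit n i j) *\<^sub>v v \<in> carrier_vec n"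
        by (rule mult_mat_vec_carrier[OF E v])
      moreover have "conjugate v \<in> carrier_vec n" using v by simp
      ultimately show ?thesis
        by (simp only: conjugate_smult_vec smult_scalar_prod_distrib[of _ n]
            scalar_prod_smult_distrib[of _ n] smult_carrier_vec mult_ac)
    qed
    moreover have "0 \<le> (\<Sum>i<n. \<Sum>j<n. (L (matrix_unit n i j) *\<^sub>v (u j \<cdot>\<^sub>v v)) \<bullet>c (u i \<cdot>\<^sub>v v))"
      by (rule choi) (simp add: v)
    ultimately show "0 \<le> (\<Sum>i<n. \<Sum>j<n. ((L (matrix_unit n i j) *\<^sub>v v) \<bullet>c v) * u j * conjugate (u i))"
      by (simp only:)
  qed
  thus "psd_mat n (L X)"
    using closed[OF X] adjoint[OF X, unfolded herm, symmetric]
    by (simp add: psd_mat_def hermitian_mat_def)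
qed

text \<open>
  Writing \<open>x\<^sub>i = C\<^sub>i w\<close> with \<open>C\<^sub>i\<close> in the algebra over which \<open>L\<close> is a bimodule map,
  \<open>\<Sum> x\<^sub>i\<^sup>* L(V\<^sub>i\<^sub>j) x\<^sub>j = w\<^sup>* L(\<Sum> C\<^sub>i\<^sup>* V\<^sub>i\<^sub>j C\<^sub>j) w\<close>, and the argument of \<open>L\<close> is positive semidefinite.
\<close>
lemma completely_positive_if_cyclic_bimodule_map:
  assumes S: "\<And>C. C \<in> S \<Longrightarrow> C \<in> carrier_mat n n"
    and bimodule: "\<And>X C D. X \<in> carrier_mat n n \<Longrightarrow> C \<in> S \<Longrightarrow> D \<in> S \<Longrightarrow>
      L (mat_adjoint C * X * D) = mat_adjoint C * L X * D"
    and w: "w \<in> carrier_vec n"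
    and cyclic: "\<And>x. x \<in> carrier_vec n \<Longrightarrow> \<exists>C \<in> S. C *\<^sub>v w = x"
    and positive: "positive_map n n L"
  shows "completely_positive_map n n L"
  unfolding completely_positive_map_def positive_map_def
proof (intro allI impI)
  fix k and V :: "'a mat" assume psd: "psd_mat (k * n) V"
  define B where "B = mat_block n V"
  have B: "B i j \<in> carrier_mat n n" for i j by (simp add: B_def)
  have V: "block_mat k n B = V"
    using psd by (simp add: B_def psd_mat_def block_mat_mat_block)
  have "psd_mat (k * n) (block_mat k n B)" unfolding V by (rule psd)
  note psd' = psd_block_mat_iff[of k B n, OF B, THEN iffD1, OF this]
  have herm: "\<And>i j. i < k \<Longrightarrow> j < k \<Longrightarrow> B j i = mat_adjoint (B i j)"
    and pos: "\<And>x. (\<And>i. i < k \<Longrightarrow> x i \<in> carrier_vec n) \<Longrightarrow>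
      0 \<le> (\<Sum>i<k. \<Sum>j<k. (B i j *\<^sub>v x j) \<bullet>c x i)"
    using psd'[THEN conjunct1] psd'[THEN conjunct2] by blast+
  have "psd_mat (k * n) (block_mat k n (\<lambda>i j. L (B i j)))"
  proof (rule psd_block_mat_iff[of k "\<lambda>i j. L (B i j)" n, THEN iffD2])
    show "(\<forall>i<k. \<forall>j<k. L (B j i) = mat_adjoint (L (B i j))) \<and>
      (\<forall>x. (\<forall>i<k. x i \<in> carrier_vec n) \<longrightarrow> 0 \<le> (\<Sum>i<k. \<Sum>j<k. (L (B i j) *\<^sub>v x j) \<bullet>c x i))"
    proof (intro conjI allI impI)
      fix i j assume ij: "i < k" "j < k"
      show "L (B j i) = mat_adjoint (L (B i j))"
        unfolding herm[OF ij] by (rule adjoint[OF B])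
    next
      fix x :: "nat \<Rightarrow> 'a vec" assume x: "\<forall>i<k. x i \<in> carrier_vec n"
      have "\<forall>i \<in> {..<k}. \<exists>C. C \<in> S \<and> C *\<^sub>v w = x i" using x cyclic by blast
      from bchoice[OF this] obtain C
        where C: "\<And>i. i < k \<Longrightarrow> C i \<in> S" "\<And>i. i < k \<Longrightarrow> C i *\<^sub>v w = x i"
        by auto
      have Cc: "C i \<in> carrier_mat n n" "mat_adjoint (C i) \<in> carrier_mat n n" if "i < k" for i
        using S C that by auto
      have form: "((mat_adjoint (C i) * Z * C j) *\<^sub>v u) \<bullet>c u = (Z *\<^sub>v (C j *\<^sub>v u)) \<bullet>c (C i *\<^sub>v u)"
        if ij: "i < k" "j < k" and Z: "Z \<in> carrier_mat n n" and u: "u \<in> carrier_vec n" for i j Z u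
      proof -
        have cj: "C j *\<^sub>v u \<in> carrier_vec n" using Cc[OF ij(2)] u by simp
        have ZC: "Z *\<^sub>v (C j *\<^sub>v u) \<in> carrier_vec n" using Z cj by simp
        have "(mat_adjoint (C i) * Z * C j) *\<^sub>v u = mat_adjoint (C i) *\<^sub>v (Z *\<^sub>v (C j *\<^sub>v u))"
          using assoc_mult_mat_vec[OF mult_carrier_mat[OF Cc(2)[OF ij(1)] Z] Cc(1)[OF ij(2)] u]
            assoc_mult_mat_vec[OF Cc(2)[OF ij(1)] Z cj] by simp
        also have "\<dots> \<bullet>c u = (Z *\<^sub>v (C j *\<^sub>v u)) \<bullet>c (C i *\<^sub>v u)"
          using mat_adjoint_cscalar_prod[OF Cc(2)[OF ij(1)] ZC u] by simp
        finally show ?thesis .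
      qed
      define F where "F = (\<lambda>(i, j). mat_adjoint (C i) * B i j * C j)"
      let ?I = "{..<k} \<times> {..<k}"
      have F: "F p \<in> carrier_mat n n" if "p \<in> ?I" for p
        using that by (auto simp: F_def intro!: mult_carrier_mat[OF mult_carrier_mat[OF Cc(2) B] Cc(1)])
      have LF: "L (F p) \<in> carrier_mat n n" if "p \<in> ?I" for p using F[OF that] by (rule closed)
      \<comment> \<open>This is the congruence of \<open>V\<close> by the block column of the
        \<open>C i\<close>; its form at \<open>u\<close> is that of \<open>V\<close> at the tuple
        \<open>C i *\<^sub>v u\<close>.\<close>
      define T where "T = matsum n ?I F"
      have "psd_mat n T"
        unfolding psd_mat_def hermitian_mat_def
      proof (intro conjI ballI)
        show "T \<in> carrier_mat n n" by (simp add: T_def)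
        show "mat_adjoint T = T"
        proof (rule eq_matI)
          fix a b assume "a < dim_row T" "b < dim_col T"
          hence ab: "a < n" "b < n" by (auto simp: T_def matsum_def)
          have swap: "conjugate (F (i, j) $$ (b, a)) = F (j, i) $$ (a, b)" if ij: "i < k" "j < k" for i j
          proof -
            have FF: "F (i, j) = mat_adjoint (C i) * B i j * C j" by (simp add: F_def)
            have "mat_adjoint (F (i, j)) = mat_adjoint (C j) * (mat_adjoint (B i j) * C i)"
              unfolding FF
              using mat_adjoint_mult[OF mult_carrier_mat[OF Cc(2)[OF ij(1)] B] Cc(1)[OF ij(2)]]
                mat_adjoint_mult[OF Cc(2)[OF ij(1)] B] by simp
            also have "\<dots> = mat_adjoint (C j) * B j i * C i"
              unfolding herm[OF ij, symmetric]
              by (rule assoc_mult_mat[OF Cc(2)[OF ij(2)] B Cc(1)[OF ij(1)], symmetric])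
            finally have "mat_adjoint (F (i, j)) = F (j, i)" by (simp add: F_def)
            moreover have "F (i, j) \<in> carrier_mat n n" using F ij by simp
            ultimately show ?thesis using ab mat_adjoint_index[of a "F (i, j)" b] by simp
          qed
          have "mat_adjoint T $$ (a, b) = conjugate (T $$ (b, a))"
            using ab by (intro mat_adjoint_index) (auto simp: T_def matsum_def)
          also have "\<dots> = (\<Sum>i<k. \<Sum>j<k. conjugate (F (i, j) $$ (b, a)))"
            using ab by (simp add: T_def sum_conjugate sum.cartesian_product split_def)
          also have "\<dots> = (\<Sum>i<k. \<Sum>j<k. F (j, i) $$ (a, b))"
            by (intro sum.cong refl) (simp add: swap)
          also have "\<dots> = (\<Sum>j<k. \<Sum>i<k. F (j, i) $$ (a, b))" by (rule sum.swap)
          also have "\<dots> = T $$ (a, b)"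
            using ab by (simp add: T_def sum.cartesian_product split_def)
          finally show "mat_adjoint T $$ (a, b) = T $$ (a, b)" .
        qed (auto simp: T_def matsum_def)
        fix u :: "'a vec" assume u: "u \<in> carrier_vec n"
        have "(T *\<^sub>v u) \<bullet>c u = (\<Sum>p\<in>?I. (F p *\<^sub>v u) \<bullet>c u)"
          unfolding T_def by (rule quadratic_form_matsum[OF F u u])
        also have "\<dots> = (\<Sum>i<k. \<Sum>j<k. (F (i, j) *\<^sub>v u) \<bullet>c u)"
          by (simp add: sum.cartesian_product split_def)
        also have "\<dots> = (\<Sum>i<k. \<Sum>j<k. (B i j *\<^sub>v (C j *\<^sub>v u)) \<bullet>c (C i *\<^sub>v u))"
          by (intro sum.cong refl) (simp add: F_def form[OF _ _ B u])
        also have "0 \<le> \<dots>"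
          by (rule pos) (rule mult_mat_vec_carrier[OF Cc(1) u])
        finally show "0 \<le> (T *\<^sub>v u) \<bullet>c u" .
      qed
      hence "0 \<le> (L T *\<^sub>v w) \<bullet>c w"
        using positive w by (simp add: positive_map_def psd_mat_def)
      also have "L T = matsum n ?I (\<lambda>p. L (F p))" unfolding T_def by (rule matsum[OF _ F]) simp_all
      also have "(\<dots> *\<^sub>v w) \<bullet>c w = (\<Sum>p\<in>?I. (L (F p) *\<^sub>v w) \<bullet>c w)"
        by (rule quadratic_form_matsum[OF LF w w])
      also have "\<dots> = (\<Sum>i<k. \<Sum>j<k. (L (F (i, j)) *\<^sub>v w) \<bullet>c w)"
        by (simp add: sum.cartesian_product split_def)
      also have "\<dots> = (\<Sum>i<k. \<Sum>j<k. (L (B i j) *\<^sub>v x j) \<bullet>c x i)"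
        by (intro sum.cong refl) (simp add: F_def bimodule[OF B C(1) C(1)] form[OF _ _ closed[OF B] w] C(2))
      finally show "0 \<le> (\<Sum>i<k. \<Sum>j<k. (L (B i j) *\<^sub>v x j) \<bullet>c x i)" .
    qed
  qed (rule closed[OF B])
  thus "psd_mat (k * n) (block_mat k n (\<lambda>i j. L (mat_block n V i j)))" by (simp only: B_def)
qed

end

subsection \<open>Lyapunov operators\<close>

lemma lyapunov_op_linear:
  assumes A: "A \<in> carrier_mat n n"
  shows "linear_star_map n (lyapunov_op (A :: 'a :: {conjugatable_ordered_field, ordered_comm_ring} mat))"
proof
  have A': "mat_adjoint A \<in> carrier_mat n n" using A by simp
  fix X :: "'a mat" assume X: "X \<in> carrier_mat n n"
  have c: "X * A \<in> carrier_mat n n" "mat_adjoint A * X \<in> carrier_mat n n"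
    using mult_carrier_mat[OF X A] mult_carrier_mat[OF A' X] .
  show "lyapunov_op A X \<in> carrier_mat n n"
    unfolding lyapunov_op_def using c(2) by (rule add_carrier_mat)
  show "lyapunov_op A (c \<cdot>\<^sub>m X) = c \<cdot>\<^sub>m lyapunov_op A X" for c
    unfolding lyapunov_op_def mult_smult_assoc_mat[OF X A] mult_smult_distrib[OF A' X]
    by (rule add_smult_distrib_left_mat[OF c, symmetric])
  show "lyapunov_op A (mat_adjoint X) = mat_adjoint (lyapunov_op A X)"
    unfolding lyapunov_op_def mat_adjoint_add[OF c] mat_adjoint_mult[OF X A] mat_adjoint_mult[OF A' X]
    using mult_carrier_mat[OF A' mat_adjoint_carrier(1)[OF X]] mult_carrier_mat[OF mat_adjoint_carrier(1)[OF X] A]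
    by (simp add: comm_add_mat[of _ n n])
  fix Y :: "'a mat" assume Y: "Y \<in> carrier_mat n n"
  have d: "Y * A \<in> carrier_mat n n" "mat_adjoint A * Y \<in> carrier_mat n n"
    using mult_carrier_mat[OF Y A] mult_carrier_mat[OF A' Y] .
  show "lyapunov_op A (X + Y) = lyapunov_op A X + lyapunov_op A Y"
    unfolding lyapunov_op_def add_mult_distrib_mat[OF X Y A] mult_add_distrib_mat[OF A' X Y]
    using c d by (intro eq_matI) (auto simp del: index_mult_mat)
qed

text \<open>\<open>D\<close> passes \<open>A\<close> on the right; on the left, taking adjoints in
  \<open>C * A = A * C\<close> shows that the adjoint of \<open>C\<close> commutes with that of
  \<open>A\<close>.\<close>

lemma lyapunov_op_bimodule:
  fixes A :: "'a :: {conjugatable_ordered_field, ordered_comm_ring} mat"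
  assumes A: "A \<in> carrier_mat n n" and X: "X \<in> carrier_mat n n"
    and C: "C \<in> carrier_mat n n" "C * A = A * C" and D: "D \<in> carrier_mat n n" "D * A = A * D"
  shows "lyapunov_op A (mat_adjoint C * X * D) = mat_adjoint C * lyapunov_op A X * D"
proof -
  let ?A = "mat_adjoint A" and ?C = "mat_adjoint C"
  have A': "?A \<in> carrier_mat n n" and C': "?C \<in> carrier_mat n n" using A C by simp_all
  have comm: "?A * ?C = ?C * ?A"
    using mat_adjoint_mult[OF C(1) A] mat_adjoint_mult[OF A C(1)] C(2) by simp
  have XD: "X * D \<in> carrier_mat n n" and CX: "?C * X \<in> carrier_mat n n"
    and XA: "X * A \<in> carrier_mat n n" and AX: "?A * X \<in> carrier_mat n n"
    using mult_carrier_mat[OF X D(1)] mult_carrier_mat[OF C' X] mult_carrier_mat[OF X A]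
      mult_carrier_mat[OF A' X] by auto
  have "?C * X * D * A = ?C * X * (D * A)" by (rule assoc_mult_mat[OF CX D(1) A])
  also have "\<dots> = ?C * X * A * D"
    unfolding D(2) by (rule assoc_mult_mat[OF CX A D(1), symmetric])
  also have "?C * X * A = ?C * (X * A)" by (rule assoc_mult_mat[OF C' X A])
  finally have 1: "?C * X * D * A = ?C * (X * A) * D" .
  have "?A * (?C * X * D) = ?A * (?C * X) * D" by (rule assoc_mult_mat[OF A' CX D(1), symmetric])
  also have "?A * (?C * X) = ?A * ?C * X" by (rule assoc_mult_mat[OF A' C' X, symmetric])
  also have "\<dots> = ?C * (?A * X)" unfolding comm by (rule assoc_mult_mat[OF C' A' X])
  finally have 2: "?A * (?C * X * D) = ?C * (?A * X) * D" .
  show ?thesis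
    unfolding lyapunov_op_def 1 2 mult_add_distrib_mat[OF C' XA AX]
    by (rule add_mult_distrib_mat[OF mult_carrier_mat[OF C' XA] mult_carrier_mat[OF C' AX] D(1), symmetric])
qed

text \<open>Every matrix has the form \<open>lyapunov_op A X\<close>, so the quotient is governed by
  its values there, and linearity and adjoints transfer from the two Lyapunov operators.\<close>

lemma
  fixes A :: "'a :: {conjugatable_ordered_field, ordered_comm_ring} mat"
  assumes A: "A \<in> carrier_mat n n" and B: "B \<in> carrier_mat n n"
    and inj: "\<forall>X \<in> carrier_mat n n. lyapunov_op A X = 0\<^sub>m n n \<longrightarrow> X = 0\<^sub>m n n"
  shows lyapunov_quot_lyapunov_op:
      "X \<in> carrier_mat n n \<Longrightarrow> lyapunov_quot n A B (lyapunov_op A X) = lyapunov_op B X"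
    and lyapunov_op_surj:
      "Y \<in> carrier_mat n n \<Longrightarrow> \<exists>X \<in> carrier_mat n n. Y = lyapunov_op A X"
    and lyapunov_quot_linear_star_map: "linear_star_map n (lyapunov_quot n A B)"
proof -
  interpret LA: linear_star_map n "lyapunov_op A" by (rule lyapunov_op_linear[OF A])
  interpret LB: linear_star_map n "lyapunov_op B" by (rule lyapunov_op_linear[OF B])
  have "inj_on (lyapunov_op A) (carrier_mat n n)"
  proof (rule inj_onI)
    fix X Y assume X: "X \<in> carrier_mat n n" and Y: "Y \<in> carrier_mat n n"
      and eq: "lyapunov_op A X = lyapunov_op A Y"
    have mY: "(- 1) \<cdot>\<^sub>m Y \<in> carrier_mat n n" using Y by simp
    have "lyapunov_op A (X + (- 1) \<cdot>\<^sub>m Y) = 0\<^sub>m n n"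
      unfolding LA.add[OF X mY] LA.smult[OF Y] eq
      using LA.closed[OF Y] by (intro eq_matI) auto
    hence 0: "X + (- 1) \<cdot>\<^sub>m Y = 0\<^sub>m n n" using inj add_carrier_mat[OF mY, of X] by blast
    show "X = Y"
    proof (rule eq_matI)
      fix i j assume "i < dim_row Y" "j < dim_col Y"
      thus "X $$ (i, j) = Y $$ (i, j)"
        using arg_cong[OF 0, of "\<lambda>Z. Z $$ (i, j)"] X Y by simp
    qed (use X Y in auto)
  qed
  thus quot: "lyapunov_quot n A B (lyapunov_op A X) = lyapunov_op B X"
    if "X \<in> carrier_mat n n" for X
    using that by (simp add: lyapunov_quot_def)
  show surj: "\<exists>X \<in> carrier_mat n n. Y = lyapunov_op A X" if "Y \<in> carrier_mat n n" for Y
    using LA.surjective_if_injective[OF _ that] inj by metis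
  show "linear_star_map n (lyapunov_quot n A B)"
  proof
    fix Y :: "'a mat" assume "Y \<in> carrier_mat n n"
    then obtain X where X: "X \<in> carrier_mat n n" and Y: "Y = lyapunov_op A X" using surj by blast
    show "lyapunov_quot n A B Y \<in> carrier_mat n n"
      unfolding Y quot[OF X] by (rule LB.closed[OF X])
    show "lyapunov_quot n A B (c \<cdot>\<^sub>m Y) = c \<cdot>\<^sub>m lyapunov_quot n A B Y" for c
      unfolding Y LA.smult[OF X, symmetric] quot[OF X] quot[OF smult_carrier_mat[OF X]]
      by (rule LB.smult[OF X])
    show "lyapunov_quot n A B (mat_adjoint Y) = mat_adjoint (lyapunov_quot n A B Y)"
      unfolding Y LA.adjoint[OF X, symmetric] quot[OF X] quot[OF mat_adjoint_carrier(1)[OF X]]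
      by (rule LB.adjoint[OF X])
    fix Y' :: "'a mat" assume "Y' \<in> carrier_mat n n"
    then obtain X' where X': "X' \<in> carrier_mat n n" and Y': "Y' = lyapunov_op A X'" using surj by blast
    show "lyapunov_quot n A B (Y + Y') = lyapunov_quot n A B Y + lyapunov_quot n A B Y'"
      unfolding Y Y' LA.add[OF X X', symmetric] quot[OF X] quot[OF X'] quot[OF add_carrier_mat[OF X']]
      by (rule LB.add[OF X X'])
  qed
qed

text \<open>Regularity is replaced by its consequence \<open>inj\<close>, which makes one proof
  serve both fields. Infinitude and \<open>field_gcd\<close> supply the pigeonhole argument and the
  polynomial factorizations behind the cyclic vector. The three properties are linked in a cycle of
  implications.\<close>

lemma lyapunov_quot_positive_iff:
  fixes A B :: "'a :: {conjugatable_ordered_field, ordered_comm_ring, field_gcd} mat"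
  assumes inf: "infinite (UNIV :: 'a set)"
    and A: "A \<in> carrier_mat n n" and bicomm: "B \<in> bicommutant n A"
    and inj: "\<forall>X \<in> carrier_mat n n. lyapunov_op A X = 0\<^sub>m n n \<longrightarrow> X = 0\<^sub>m n n"
  shows "(positive_map n n (lyapunov_quot n A B) \<longleftrightarrow>
            completely_positive_map n n (lyapunov_quot n A B)) \<and>
         (positive_map n n (lyapunov_quot n A B) \<longleftrightarrow>
            psd_mat (n^2) (choi_mat n n (lyapunov_quot n A B)))"
proof -
  let ?L = "lyapunov_quot n A B"
  have B: "B \<in> carrier_mat n n" using bicomm by (simp add: bicommutant_def)
  interpret linear_star_map n ?L by (rule lyapunov_quot_linear_star_map[OF A B inj])
  define S where "S = {C \<in> carrier_mat n n. C * A = A * C}"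
  have bimodule: "?L (mat_adjoint C * Y * D) = mat_adjoint C * ?L Y * D"
    if Y: "Y \<in> carrier_mat n n" and CD: "C \<in> S" "D \<in> S" for Y C D
  proof -
    obtain X where X: "X \<in> carrier_mat n n" and Y: "Y = lyapunov_op A X"
      using lyapunov_op_surj[OF A B inj Y] by blast
    have C: "C \<in> carrier_mat n n" "C * A = A * C" and D: "D \<in> carrier_mat n n" "D * A = A * D"
      using CD by (auto simp: S_def)
    \<comment> \<open>The bicommutant hypothesis enters here: it makes both Lyapunov operators
      bimodule maps over the same algebra \<open>S\<close>.\<close>
    have CB: "C * B = B * C" and DB: "D * B = B * D"
      using bicomm C D by (auto simp: bicommutant_def)
    have "mat_adjoint C * X * D \<in> carrier_mat n n"
      using C D X by (intro mult_carrier_mat[of _ n n]) auto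
    thus ?thesis
      unfolding Y lyapunov_op_bimodule[OF A X C D, symmetric]
        lyapunov_quot_lyapunov_op[OF A B inj X] lyapunov_op_bimodule[OF B X C(1) CB D(1) DB, symmetric]
      by (rule lyapunov_quot_lyapunov_op[OF A B inj])
  qed
  obtain w where w: "w \<in> carrier_vec n"
    and cyclic: "\<And>x. x \<in> carrier_vec n \<Longrightarrow> \<exists>C \<in> carrier_mat n n. C * A = A * C \<and> C *\<^sub>v w = x"
    by (rule commutant_cyclic_vector[OF A inf]) blast
  have S: "C \<in> carrier_mat n n" if "C \<in> S" for C using that by (simp add: S_def)
  have "\<exists>C \<in> S. C *\<^sub>v w = x" if "x \<in> carrier_vec n" for x
    using cyclic[OF that] by (auto simp: S_def)
  note cp = completely_positive_if_cyclic_bimodule_map[of S, OF S bimodule w this]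
  show ?thesis
    using cp completely_positive_imp_psd_choi[of n n ?L] positive_if_psd_choi
    unfolding power2_eq_square by blast
qed

section \<open>Injectivity of the Lyapunov operator of a regular matrix\<close>

text \<open>
  Triangularise \<open>A = P T P\<^sup>-\<^sup>1\<close> and let \<open>y\<close> be the first nonzero column of \<open>X P\<close>, say the \<open>k\<close>-th one.
  Then \<open>- A\<^sup>* y = X A P e\<^sub>k = T\<^sub>k\<^sub>k y\<close>, so \<open>T\<^sub>k\<^sub>k\<close> and \<open>- cnj T\<^sub>k\<^sub>k\<close> are both eigenvalues of \<open>A\<close>.
\<close>
lemma lyapunov_op_injective_complex:
  fixes A :: "complex mat"
  assumes A: "A \<in> carrier_mat n n" and reg: "lyapunov_regular A"
    and X: "X \<in> carrier_mat n n" and zero: "lyapunov_op A X = 0\<^sub>m n n"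
  shows "X = 0\<^sub>m n n"
proof (rule ccontr)
  assume "X \<noteq> 0\<^sub>m n n"
  obtain as where "char_poly A = (\<Prod>a\<leftarrow>as. [:- a, 1:])" using char_poly_factorized[OF A] by blast
  then obtain T where T: "T \<in> carrier_mat n n" "upper_triangular T" and sim: "similar_mat A T"
    using schur_decomposition_exists[OF A] by blast
  from sim obtain P Q where "similar_mat_wit A T P Q" by (auto simp: similar_mat_def)
  from similar_mat_witD2[OF A this] have P: "P \<in> carrier_mat n n" and Q: "Q \<in> carrier_mat n n"
    and PQ: "P * Q = 1\<^sub>m n" "Q * P = 1\<^sub>m n" and APTQ: "A = P * T * Q" by auto
  have A': "mat_adjoint A \<in> carrier_mat n n" using A by simp
  have PT: "P * T \<in> carrier_mat n n" using mult_carrier_mat[OF P T(1)] .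
  have AP: "A * P = P * T"
    unfolding APTQ assoc_mult_mat[OF PT Q P] PQ(2) by (rule right_mult_one_mat[OF PT])
  define Z where "Z = X * P"
  have Z: "Z \<in> carrier_mat n n" unfolding Z_def by (rule mult_carrier_mat[OF X P])
  have XA: "X * A \<in> carrier_mat n n" and AX: "mat_adjoint A * X \<in> carrier_mat n n"
    using mult_carrier_mat[OF X A] mult_carrier_mat[OF A' X] .
  have "X * A * P + mat_adjoint A * X * P = (X * A + mat_adjoint A * X) * P"
    by (rule add_mult_distrib_mat[OF XA AX P, symmetric])
  also have "\<dots> = 0\<^sub>m n n" using zero P by (simp add: lyapunov_op_def)
  also have "X * A * P = Z * T"
    unfolding Z_def assoc_mult_mat[OF X A P] AP by (rule assoc_mult_mat[OF X P T(1), symmetric])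
  also have "mat_adjoint A * X * P = mat_adjoint A * Z"
    unfolding Z_def by (rule assoc_mult_mat[OF A' X P])
  finally have ZT: "Z * T + mat_adjoint A * Z = 0\<^sub>m n n" .
  have "\<exists>k. k < n \<and> col Z k \<noteq> 0\<^sub>v n"
  proof (rule ccontr)
    assume "\<nexists>k. k < n \<and> col Z k \<noteq> 0\<^sub>v n"
    hence col0: "col Z j = 0\<^sub>v n" if "j < n" for j using that by blast
    have "Z = 0\<^sub>m n n"
    proof (rule eq_matI)
      fix i j assume "i < dim_row (0\<^sub>m n n :: complex mat)" "j < dim_col (0\<^sub>m n n :: complex mat)"
      thus "Z $$ (i, j) = 0\<^sub>m n n $$ (i, j)"
        using arg_cong[OF col0[of j], of "\<lambda>v. v $ i"] Z by simp
    qed (use Z in auto)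
    moreover have "X = Z * Q"
      unfolding Z_def assoc_mult_mat[OF X P Q] PQ(1) by (rule right_mult_one_mat[OF X, symmetric])
    ultimately have "X = 0\<^sub>m n n" using Q by simp
    with \<open>X \<noteq> 0\<^sub>m n n\<close> show False ..
  qed
  then obtain k where k: "k < n" "col Z k \<noteq> 0\<^sub>v n"
    and min: "\<And>j. j < k \<Longrightarrow> j < n \<Longrightarrow> col Z j = 0\<^sub>v n"
    using exists_least_iff[of "\<lambda>k. k < n \<and> col Z k \<noteq> 0\<^sub>v n"] by blast
  define t where "t = T $$ (k, k)"
  \<comment> \<open>Conjugation turns the eigenvector equation for the adjoint into one for the
    transpose, which has the same characteristic polynomial as \<open>A\<close>.\<close>
  let ?y = "conjugate (col Z k)"
  have colZ: "col Z k \<in> carrier_vec n" using Z by (intro carrier_vecI) simp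
  have y: "?y \<in> carrier_vec n" using colZ by simp
  have A'Z: "(mat_adjoint A *\<^sub>v col Z k) $ i = - t * Z $$ (i, k)" if i: "i < n" for i
  proof -
    have "(Z * T) $$ (i, k) = (\<Sum>l<n. Z $$ (i, l) * T $$ (l, k))"
      using i k Z T by (auto simp: scalar_prod_def lessThan_atLeast0)
    \<comment> \<open>Minimality of \<open>k\<close> removes the terms with \<open>l < k\<close>,
      triangularity of \<open>T\<close> those with \<open>k < l\<close>.\<close>
    also have "\<dots> = (\<Sum>l<n. if l = k then Z $$ (i, k) * t else 0)"
    proof (intro sum.cong refl)
      fix l assume "l \<in> {..<n}"
      hence l: "l < n" by simp
      consider "l < k" | "l = k" | "k < l" by linarith
      thus "Z $$ (i, l) * T $$ (l, k) = (if l = k then Z $$ (i, k) * t else 0)"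
      proof cases
        case 1
        hence "Z $$ (i, l) = 0"
          using arg_cong[OF min[OF 1 l], of "\<lambda>v. v $ i"] i l Z by simp
        with 1 show ?thesis by simp
      next
        case 3
        hence "T $$ (l, k) = 0" using T l by (intro upper_triangularD) auto
        with 3 show ?thesis by simp
      qed (simp add: t_def)
    qed
    also have "\<dots> = Z $$ (i, k) * t" using k by simp
    finally have "Z $$ (i, k) * t + (mat_adjoint A * Z) $$ (i, k) = 0"
      using arg_cong[OF ZT, of "\<lambda>W. W $$ (i, k)"] i k Z T A by simp
    moreover have "(mat_adjoint A * Z) $$ (i, k) = (mat_adjoint A *\<^sub>v col Z k) $ i"
      using i k A Z by simp
    ultimately show ?thesis by (simp add: eq_neg_iff_add_eq_0 mult.commute add.commute)
  qed
  have "A\<^sup>T *\<^sub>v ?y = (- cnj t) \<cdot>\<^sub>v ?y"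
  proof (rule eq_vecI)
    fix i assume "i < dim_vec ((- cnj t) \<cdot>\<^sub>v ?y)"
    hence i: "i < n" using Z by simp
    have "(A\<^sup>T *\<^sub>v ?y) $ i = cnj ((mat_adjoint A *\<^sub>v col Z k) $ i)"
      using i k A Z by (auto simp: scalar_prod_def intro!: sum.cong)
    thus "(A\<^sup>T *\<^sub>v ?y) $ i = ((- cnj t) \<cdot>\<^sub>v ?y) $ i"
      unfolding A'Z[OF i] using i k Z by simp
  qed (use A Z in simp)
  moreover have "?y \<noteq> 0\<^sub>v n" using k(2) by simp
  ultimately have "eigenvalue (A\<^sup>T) (- cnj t)"
    using y A by (auto simp: eigenvalue_def eigenvector_def intro!: exI[of _ ?y])
  hence "eigenvalue A (- cnj t)"
    using A by (simp add: eigenvalue_root_char_poly[of _ n])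
  moreover have "eigenvalue A t"
  proof -
    have "t \<in> set (diag_mat T)" using T(1) k by (auto simp: diag_mat_def t_def)
    hence "poly (\<Prod>a\<leftarrow>diag_mat T. [:- a, 1:]) t = 0"
      by (auto simp: poly_prod_list prod_list_zero_iff)
    thus ?thesis
      unfolding eigenvalue_root_char_poly[OF A] char_poly_similar[OF sim]
        char_poly_upper_triangular[OF T] .
  qed
  ultimately have "t + cnj (- cnj t) \<noteq> 0" using reg unfolding lyapunov_regular_def by blast
  thus False by simp
qed

text \<open>Embedding the entries into the complex numbers commutes with products and adjoints, so a
  real kernel element is also a complex one.\<close>

lemma lyapunov_op_injective_real:
  fixes A :: "real mat"
  assumes A: "A \<in> carrier_mat n n" and reg: "lyapunov_regular (map_mat complex_of_real A)"
    and X: "X \<in> carrier_mat n n" and zero: "lyapunov_op A X = 0\<^sub>m n n"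
  shows "X = 0\<^sub>m n n"
proof -
  let ?c = "map_mat complex_of_real"
  have A': "mat_adjoint A \<in> carrier_mat n n" using A by simp
  have adj: "mat_adjoint (?c A) = ?c (mat_adjoint A)"
    by (rule eq_matI) simp_all
  have c: "X * A \<in> carrier_mat n n" "mat_adjoint A * X \<in> carrier_mat n n"
    using mult_carrier_mat[OF X A] mult_carrier_mat[OF A' X] .
  have "lyapunov_op (?c A) (?c X) = ?c (X * A) + ?c (mat_adjoint A * X)"
    unfolding lyapunov_op_def adj of_real_hom.mat_hom_mult[OF X A] of_real_hom.mat_hom_mult[OF A' X] ..
  also have "\<dots> = ?c (X * A + mat_adjoint A * X)"
    by (rule eq_matI) (use A X in \<open>simp_all del: index_mult_mat(1)\<close>)
  also have "\<dots> = 0\<^sub>m n n"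
    using zero unfolding lyapunov_op_def by (intro eq_matI) simp_all
  finally have c0: "lyapunov_op (?c A) (?c X) = 0\<^sub>m n n" .
  have c: "?c X = 0\<^sub>m n n"
    by (rule lyapunov_op_injective_complex[OF _ reg _ c0]) (use A X in simp_all)
  show ?thesis
  proof (rule eq_matI)
    fix i j assume "i < dim_row (0\<^sub>m n n :: real mat)" "j < dim_col (0\<^sub>m n n :: real mat)"
    thus "X $$ (i, j) = 0\<^sub>m n n $$ (i, j)"
      using arg_cong[OF c, of "\<lambda>Z. Z $$ (i, j)"] X by simp
  qed (use X in simp_all)
qed

theorem theorem1p1:
  fixes n :: nat
  shows
    "(\<forall>A B :: complex mat.
        A \<in> carrier_mat n n \<longrightarrow> B \<in> carrier_mat n n \<longrightarrow>
        lyapunov_regular A \<longrightarrow> B \<in> bicommutant n A \<longrightarrow>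
          (positive_map n n (lyapunov_quot n A B) \<longleftrightarrow>
             completely_positive_map n n (lyapunov_quot n A B)) \<and>
          (positive_map n n (lyapunov_quot n A B) \<longleftrightarrow>
             psd_mat (n^2) (choi_mat n n (lyapunov_quot n A B)))) \<and>
     (\<forall>A B :: real mat.
        A \<in> carrier_mat n n \<longrightarrow> B \<in> carrier_mat n n \<longrightarrow>
        lyapunov_regular (map_mat complex_of_real A) \<longrightarrow> B \<in> bicommutant n A \<longrightarrow>
          (positive_map n n (lyapunov_quot n A B) \<longleftrightarrow>
             completely_positive_map n n (lyapunov_quot n A B)) \<and>
          (positive_map n n (lyapunov_quot n A B) \<longleftrightarrow>
             psd_mat (n^2) (choi_mat n n (lyapunov_quot n A B))))"
proof (rule conjI; intro allI impI)
  fix A B :: "complex mat"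
  assume A: "A \<in> carrier_mat n n" and reg: "lyapunov_regular A" and B: "B \<in> bicommutant n A"
  show "(positive_map n n (lyapunov_quot n A B) \<longleftrightarrow>
             completely_positive_map n n (lyapunov_quot n A B)) \<and>
          (positive_map n n (lyapunov_quot n A B) \<longleftrightarrow>
             psd_mat (n^2) (choi_mat n n (lyapunov_quot n A B)))"
    by (rule lyapunov_quot_positive_iff[OF infinite_UNIV_char_0 A B])
      (intro ballI impI, rule lyapunov_op_injective_complex[OF A reg])
next
  fix A B :: "real mat"
  assume A: "A \<in> carrier_mat n n" and reg: "lyapunov_regular (map_mat complex_of_real A)" and B: "B \<in> bicommutant n A"
  show "(positive_map n n (lyapunov_quot n A B) \<longleftrightarrow>
             completely_positive_map n n (lyapunov_quot n A B)) \<and>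
          (positive_map n n (lyapunov_quot n A B) \<longleftrightarrow>
             psd_mat (n^2) (choi_mat n n (lyapunov_quot n A B)))"
    by (rule lyapunov_quot_positive_iff[OF infinite_UNIV_char_0 A B])
      (intro ballI impI, rule lyapunov_op_injective_real[OF A reg])
qed

end
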